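(* Let $s \geq t \geq 2$ be fixed integers and let $G$ be a $K_{s,t}$-free graph with minimum degree $d$. Let $T$ be a tree with $|T| \leq \frac{1}{64} s^{-1/(t-1)} d^{t/(t-1)}$ and maximum degree $\Delta(T) \leq \frac{1}{256} d$. Then Algorithm 2 (described in the context) finds an embedding of $T$ in $G$ with high probability, i.e. with probability tending to $1$ as $d\to\infty$.
   Context: $K_{s,t}$ denotes the complete bipartite graph with parts of sizes $s$ and $t$; $G$ is $K_{s,t}$-free if it contains no (not necessarily induced) subgraph isomorphic to $K_{s,t}$. $|T|$ denotes the number of vertices of $T$. An embedding of $T$ in $G$ is an injective map $f:V(T)\to V(G)$ mapping edges to edges. Algorithm 2: for each vertex $v\in V(G)$ fix a set $N_+(v)\subseteq N(v)$ of exactly $d$ neighbors. Choose a root $r$ of $T$ and embed it at an arbitrary vertex $f(r)\in V(G)$. As long as $T$ is not completely embedded, take an arbitrary vertex $u\in V(T)$ which is embedded but whose children are not. If $N_+(f(u))$ contains enough vertices not occupied by other vertices of $T$, embed the children of $u$ one by one, each at a vertex chosen uniformly at random from the currently unoccupied vertices of $N_+(f(u))$, and continue; otherwise the algorithm fails. *)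

theory Defs
  imports
    "HOL-Probability.Probability"
    "Graph_Theory.Graph_Theory"
begin

text \<open>
  A finite simple graph is a \<^locale>\<open>pair_graph\<close>: every edge is represented by its two
  opposite arcs, so the degree of a vertex is its \<^const>\<open>out_degree\<close>.
\<close>

definition nbhd :: "'b pair_pre_digraph \<Rightarrow> 'b \<Rightarrow> 'b set" where
  "nbhd G v = {w. (v, w) \<in> parcs G}"

definition min_degree :: "'b pair_pre_digraph \<Rightarrow> nat" where
  "min_degree G = Min (out_degree (with_proj G) ` pverts G)"

definition max_degree :: "'b pair_pre_digraph \<Rightarrow> nat" where
  "max_degree G = Max (out_degree (with_proj G) ` pverts G)"

definition bipartite_free :: "nat \<Rightarrow> nat \<Rightarrow> 'b pair_pre_digraph \<Rightarrow> bool" where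
  "bipartite_free s t G \<longleftrightarrow>
     \<not> (\<exists>H. subgraph H (with_proj G) \<and> complete_bipartite_digraph s t H)"

text \<open>
  The library's \<^term>\<open>tree\<close> is a notion for directed graphs: in a symmetric digraph each edge,
  traversed back and forth, is a \<^const>\<open>pre_digraph.cycle\<close> of length 2.  The cycles of the
  undirected graph are those of length at least 3.
\<close>

definition undirected_tree :: "'a pair_pre_digraph \<Rightarrow> bool" where
  "undirected_tree T \<longleftrightarrow> pair_graph T \<and> Digraph_Component.connected (with_proj T) \<and>
     \<not> (\<exists>p. pre_digraph.cycle (with_proj T) p \<and> length p \<ge> 3)"

definition is_embedding ::
    "'a pair_pre_digraph \<Rightarrow> 'b pair_pre_digraph \<Rightarrow> ('a \<rightharpoonup> 'b) \<Rightarrow> bool" where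
  "is_embedding T G f \<longleftrightarrow> dom f = pverts T \<and> ran f \<subseteq> pverts G \<and> inj_on f (dom f) \<and>
     (\<forall>(u, v) \<in> parcs T. (the (f u), the (f v)) \<in> parcs G)"

text \<open>The neighbours of \<^term>\<open>u\<close> whose path from the root \<^term>\<open>r\<close> passes through \<^term>\<open>u\<close>.\<close>

definition children :: "'a pair_pre_digraph \<Rightarrow> 'a \<Rightarrow> 'a \<Rightarrow> 'a set" where
  "children T r u =
     {w \<in> nbhd T u. \<exists>p. vpath p (with_proj T) \<and> hd p = r \<and> last p = w \<and> u \<in> set p}"

text \<open>
  The state of the algorithm is the log of all placements (tree vertex, graph vertex) made so
  far, the latest one first.  It determines the current partial embedding, \<^const>\<open>map_of\<close> of
  the log, and records the whole history of the run.
\<close>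

type_synonym ('a, 'b) log = "('a \<times> 'b) list"

definition embedded :: "('a, 'b) log \<Rightarrow> 'a set" where
  "embedded h = fst ` set h"

definition occupied :: "('a, 'b) log \<Rightarrow> 'b set" where
  "occupied h = snd ` set h"

definition pending :: "'a pair_pre_digraph \<Rightarrow> 'a \<Rightarrow> ('a, 'b) log \<Rightarrow> 'a set" where
  "pending T r h =
     {u \<in> embedded h. children T r u \<noteq> {} \<and> children T r u \<inter> embedded h = {}}"

text \<open>
  The algorithm leaves open which vertex is processed next and in which order its children are
  placed.  A selection rule \<^term>\<open>(pick, ord)\<close> makes these choices; it may depend on the
  whole history.
\<close>

definition selection_rule :: "'a pair_pre_digraph \<Rightarrow> 'a \<Rightarrow>
    (('a, 'b) log \<Rightarrow> 'a) \<Rightarrow> (('a, 'b) log \<Rightarrow> 'a list) \<Rightarrow> bool" where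
  "selection_rule T r pick ord \<longleftrightarrow>
     (\<forall>h. pending T r h \<noteq> {} \<longrightarrow>
        pick h \<in> pending T r h \<and> distinct (ord h) \<and> set (ord h) = children T r (pick h))"

primrec place :: "'b set \<Rightarrow> 'a list \<Rightarrow> ('a, 'b) log \<Rightarrow> ('a, 'b) log pmf" where
  "place N [] h = return_pmf h"
| "place N (c # cs) h =
     bind_pmf (pmf_of_set (N - occupied h)) (\<lambda>y. place N cs ((c, y) # h))"

text \<open>
  Failure of the algorithm is \<^term>\<open>return_pmf None\<close>, i.e. the missing mass of the resulting
  subprobability distribution on embeddings.
\<close>

partial_function (spmf) algorithm2_loop :: "'a pair_pre_digraph \<Rightarrow> ('b \<Rightarrow> 'b set) \<Rightarrow>
    (('a, 'b) log \<Rightarrow> 'a) \<Rightarrow> (('a, 'b) log \<Rightarrow> 'a list) \<Rightarrow>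
    ('a, 'b) log \<Rightarrow> ('a \<rightharpoonup> 'b) spmf" where
  "algorithm2_loop T Nplus pick ord h =
     (if embedded h = pverts T then return_spmf (map_of h)
      else let N = Nplus (the (map_of h (pick h)))
           in if length (ord h) \<le> card (N - occupied h)
              then bind_spmf (spmf_of_pmf (place N (ord h) h))
                     (algorithm2_loop T Nplus pick ord)
              else return_pmf None)"

definition algorithm2 :: "'a pair_pre_digraph \<Rightarrow> ('b \<Rightarrow> 'b set) \<Rightarrow> 'a \<Rightarrow> 'b \<Rightarrow>
    (('a, 'b) log \<Rightarrow> 'a) \<Rightarrow> (('a, 'b) log \<Rightarrow> 'a list) \<Rightarrow> ('a \<rightharpoonup> 'b) spmf" where
  "algorithm2 T Nplus r x pick ord = algorithm2_loop T Nplus pick ord [(r, x)]"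

end

theory Submission
  imports Defs "HOL-Real_Asymp.Real_Asymp"
begin

text \<open>
  As long as fewer than half of the vertices of every \<open>N\<^sub>+(v)\<close> are occupied, a child of \<open>u\<close> lands in
  \<open>N\<^sub>+(v)\<close> with probability at most \<open>2 |N\<^sub>+(v) \<inter> N\<^sub>+(f(u))| / d\<close>.  The sum of these probabilities is
  the drift of \<open>v\<close>; a drift of at most \<open>d/8\<close> makes \<open>d/2\<close> hits exponentially unlikely.

  Write \<open>\<alpha> = s\<^bsup>1/(t-1)\<^esup> d\<^bsup>(t-2)/(t-1)\<^esup>\<close>.  As \<open>64 \<alpha> |T| \<le> d\<^sup>2\<close>, codegrees below \<open>2\<alpha>\<close> contribute little to the
  drift.  The codegrees of at least \<open>2\<alpha>\<close> with \<open>v\<close> (from vertices close to \<open>v\<close>) sum to at most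
  \<open>2(t-1)d\<close>, because \<open>G\<close> contains no \<open>K\<^sub>s\<^sub>,\<^sub>t\<close>.  So only the heavy tree vertices, those with a number of
  children linear in \<open>d\<close>, can do harm when placed close to \<open>v\<close>.  For \<open>t \<le> 3\<close> the degree bound on \<open>T\<close>
  excludes this, and for \<open>t \<ge> 4\<close> no \<open>v\<close> has more than four heavy tree vertices close to it, with
  high probability.

  Both tail bounds must hold for all \<open>v\<close> simultaneously, although \<open>G\<close> may have arbitrarily many
  vertices.  Hence the exponential moment of \<open>v\<close> is followed only from its \<open>\<tau>\<close>-th hit on: the tree
  vertices making the first \<open>\<tau>\<close> hits leave few choices for \<open>v\<close> (\<open>\<tau> = t\<close> for hits of \<open>N\<^sub>+(v)\<close>, as \<open>t\<close>
  vertices have fewer than \<open>s\<close> common neighbours; \<open>\<tau> = 1\<close> for heavy hits, as closeness is symmetric).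
  The resulting potential does not increase on average and is at least 1 before the algorithm can
  fail, so its initial value bounds the failure probability.
\<close>

section \<open>Children in an undirected tree\<close>

lemma pcas_vwalk_arcs: "p \<noteq> [] \<Longrightarrow> pcas (hd p) (vwalk_arcs p) (last p)"
  by (induction p rule: vwalk_arcs.induct) auto

lemma pawalk_verts_vwalk_arcs: "p \<noteq> [] \<Longrightarrow> pawalk_verts (hd p) (vwalk_arcs p) = p"
  by (induction p rule: vwalk_arcs.induct) auto

lemma mem_nbhd_iff: "w \<in> nbhd G v \<longleftrightarrow> (v, w) \<in> parcs G"
  by (simp add: nbhd_def)

lemma out_degree_eq_card_nbhd: "out_degree (with_proj G) v = card (nbhd G v)"
proof -
  have "out_arcs (with_proj G) v = Pair v ` nbhd G v"
    by (auto simp: mem_nbhd_iff out_arcs_def)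
  then show ?thesis
    by (simp add: out_degree_def card_image inj_on_def)
qed

locale rooted_tree =
  fixes T :: "'a pair_pre_digraph" and r :: 'a
  assumes tree: "undirected_tree T" and root: "r \<in> pverts T"
begin

lemma pair_graph_T: "pair_graph T"
  using tree by (simp add: undirected_tree_def)

sublocale T: pair_graph T
  by (rule pair_graph_T)

lemma parcs_sym: "(u, v) \<in> parcs T \<Longrightarrow> (v, u) \<in> parcs T"
  using T.pair_sym_arcs arcs_ends_symmetric by fastforce

text \<open>Going from \<open>c\<close> along \<open>p\<close> and back to \<open>c\<close> takes
  \<open>length p + 1\<close> arcs. With at least two vertices on \<open>p\<close> this is a cycle
  of length 3 or more, not one edge traversed back and forth.\<close>

lemma no_closing_vertex:
  assumes p: "vpath p (with_proj T)" "length p \<ge> 2" and c: "c \<notin> set p"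
    and arcs: "(c, hd p) \<in> parcs T" "(last p, c) \<in> parcs T"
  shows False
proof -
  have ne: "p \<noteq> []" using p by auto
  let ?q = "c # p @ [c]"
  have vw: "set p \<subseteq> pverts T" "set (vwalk_arcs p) \<subseteq> parcs T" "distinct p"
    using p by (auto simp: vpath_def vwalk_def)
  have "vwalk_arcs ?q = (c, hd p) # vwalk_arcs (p @ [c])"
    using ne by (cases p) auto
  moreover have "set (vwalk_arcs (p @ [c])) = insert (last p, c) (set (vwalk_arcs p))"
    using set_vwalk_arcs_snoc[OF ne] .
  ultimately have "set (vwalk_arcs ?q) \<subseteq> parcs T"
    using vw arcs by auto
  moreover have "c \<in> pverts T" using arcs T.in_arcsD1 by blast
  ultimately have "T.awalk c (vwalk_arcs ?q) c"
    using pcas_vwalk_arcs[of ?q] by (simp add: T.awalk_def)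
  moreover have "pawalk_verts c (vwalk_arcs ?q) = ?q"
    using pawalk_verts_vwalk_arcs[of ?q] by simp
  moreover have "length (vwalk_arcs ?q) \<ge> 3"
    using p vwalk_length_simp[of ?q] unfolding vwalk_length_def by simp
  moreover have "vwalk_arcs ?q \<noteq> []"
    using ne by (cases p) auto
  ultimately have "T.cycle (vwalk_arcs ?q) \<and> length (vwalk_arcs ?q) \<ge> 3"
    using vw c unfolding T.cycle_def by auto
  then show False
    using tree unfolding undirected_tree_def by blast
qed

lemma vpath_exists:
  assumes "u \<in> pverts T" "w \<in> pverts T"
  obtains p where "vpath p (with_proj T)" "hd p = u" "last p = w"
proof -
  have "strongly_connected (with_proj T)"
    using tree T.symmetric_connected_imp_strongly_connected[OF T.pair_sym_arcs]
    by (simp add: undirected_tree_def)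
  then have "u \<rightarrow>\<^sup>*\<^bsub>with_proj T\<^esub> w"
    using assms by (auto simp: strongly_connected_def)
  then show ?thesis
    using T.reachable_vpath_conv that by blast
qed

text \<open>\<open>children\<close> only asks for \<open>u\<close> to lie somewhere on a root path
  to \<open>c\<close>. If other vertices came between \<open>u\<close> and \<open>c\<close>, the
  edge between these two would close a cycle, so \<open>u\<close> is the last vertex before
  \<open>c\<close>; cutting off \<open>c\<close> leaves \<open>q\<close>.\<close>

lemma child_on_root_path:
  assumes "c \<in> children T r u"
  obtains q where "vpath q (with_proj T)" "hd q = r" "last q = u" "c \<notin> set q" "(u, c) \<in> parcs T"
proof -
  obtain p where p: "vpath p (with_proj T)" "hd p = r" "last p = c" "u \<in> set p"
    and uc: "(u, c) \<in> parcs T"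
    using assms by (auto simp: children_def mem_nbhd_iff)
  have "u \<noteq> c" using uc T.no_loops' by blast
  then obtain q1 q2 where p_eq: "p = q1 @ u # q2 @ [c]"
    using p(3,4) by (metis append_butlast_last_id last.simps last_append list.distinct(1) split_list)
  have "q2 = []"
  proof (rule ccontr)
    assume "q2 \<noteq> []"
    have vw: "vwalk ((q1 @ [u]) @ q2 @ [c]) (with_proj T)" "distinct p"
      using p p_eq by (auto simp: vpath_def)
    then have "vwalk (u # q2 @ [c]) (with_proj T)"
      using vwalkI_append_r[of "u # q2 @ [c]" q1] by simp
    then have "vwalk (u # q2) (with_proj T)" and l: "set (vwalk_arcs (u # q2 @ [c])) \<subseteq> parcs T"
      using vwalkI_append_l[of "u # q2" "[c]" "with_proj T"] by (simp, simp add: vwalk_def)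
    then have "vpath (u # q2) (with_proj T)"
      using vw p_eq by (auto simp: vpath_def)
    moreover have "(last (u # q2), c) \<in> parcs T"
      using l set_vwalk_arcs_snoc[of "u # q2" c] by (metis append_Cons insertI1 list.distinct(1) subsetD)
    moreover have "c \<notin> set (u # q2)" using vw(2) p_eq by auto
    ultimately show False
      using no_closing_vertex[of "u # q2" c] \<open>q2 \<noteq> []\<close> parcs_sym[OF uc] by (cases q2) auto
  qed
  then have "p = (q1 @ [u]) @ [c]" using p_eq by simp
  then have "vpath (q1 @ [u]) (with_proj T)" "c \<notin> set (q1 @ [u])" "hd (q1 @ [u]) = r"
    using p vwalkI_append_l[of "q1 @ [u]" "[c]" "with_proj T"] by (auto simp: vpath_def hd_append split: if_splits)
  then show ?thesis using that uc by (metis last_snoc)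
qed

text \<open>The root paths of two parents both avoid \<open>c\<close>. Joined at \<open>r\<close>
  and shortened, they form a path from \<open>u\<close> to \<open>u'\<close> that \<open>c\<close>
  would close to a cycle.\<close>

lemma parent_unique:
  assumes "c \<in> children T r u" "c \<in> children T r u'"
  shows "u = u'"
proof (rule ccontr)
  assume "u \<noteq> u'"
  obtain q where q: "vpath q (with_proj T)" "hd q = r" "last q = u" "c \<notin> set q" "(u, c) \<in> parcs T"
    using child_on_root_path[OF assms(1)] .
  obtain q' where q': "vpath q' (with_proj T)" "hd q' = r" "last q' = u'" "c \<notin> set q'" "(u', c) \<in> parcs T"
    using child_on_root_path[OF assms(2)] .
  have ne: "q \<noteq> []" "q' \<noteq> []" using q(1) q'(1) by (auto simp: vpath_def vwalk_def)
  have rev: "vwalk (rev q) (with_proj T)" "hd (rev q) = u" "last (rev q) = r"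
    using q ne vwalk_rev_ex[OF T.pair_sym_arcs, of q]
    by (auto simp: vpath_def hd_rev last_rev)
  let ?j = "rev q \<oplus> q'"
  have "vwalk ?j (with_proj T)"
    using vwalk_joinI_vwalk'[OF rev(1), of q'] q' rev by (simp add: vpath_def)
  then have P: "vpath (vwalk_to_vpath ?j) (with_proj T)"
    by (rule vwalk_to_vpath_vpath)
  have hd: "hd (vwalk_to_vpath ?j) = u"
    using ne rev by (simp add: vwalk_to_vpath_hd vwalk_join_hd')
  have last: "last (vwalk_to_vpath ?j) = u'"
    using ne rev q' by (simp add: vwalk_to_vpath_last vwalk_join_last)
  have sub: "c \<notin> set (vwalk_to_vpath ?j)"
    using vwalk_to_vpath_subset[of c ?j] q q' ne
    by (auto simp: vwalk_join_def dest: list.set_sel(2))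
  have "length (vwalk_to_vpath ?j) \<ge> 2"
    using hd last \<open>u \<noteq> u'\<close> P
    by (cases "vwalk_to_vpath ?j"; cases "tl (vwalk_to_vpath ?j)") (auto simp: vpath_def vwalk_def)
  then show False
    using no_closing_vertex[OF P _ sub] hd last parcs_sym q q' by auto
qed

text \<open>A root path to \<open>v\<close> either passes through \<open>u\<close>, or can be
  prolonged by \<open>u\<close> and is then a root path to \<open>u\<close> through
  \<open>v\<close>.\<close>

lemma child_or_parent:
  assumes "(u, v) \<in> parcs T"
  shows "v \<in> children T r u \<or> u \<in> children T r v"
proof -
  have v: "v \<in> pverts T" "u \<in> pverts T" using assms T.in_arcsD1 T.in_arcsD2 by auto
  obtain p where p: "vpath p (with_proj T)" "hd p = r" "last p = v"
    using vpath_exists[OF root v(1)] .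
  show ?thesis
  proof (cases "u \<in> set p")
    case True
    then show ?thesis using p assms by (auto simp: children_def mem_nbhd_iff)
  next
    case False
    have ne: "p \<noteq> []" using p(1) by (auto simp: vpath_def vwalk_def)
    have "vpath (p @ [u]) (with_proj T)"
      using p False ne v parcs_sym[OF assms] set_vwalk_arcs_snoc[OF ne, of u]
      by (auto simp: vpath_def vwalk_def)
    moreover have "hd (p @ [u]) = r" "last (p @ [u]) = u" "v \<in> set (p @ [u])"
      using p ne by auto
    ultimately have "u \<in> children T r v"
      using parcs_sym[OF assms] unfolding children_def mem_nbhd_iff by blast
    then show ?thesis by blast
  qed
qed

lemma children_submem_nbhd_iff: "children T r u \<subseteq> nbhd T u"
  by (auto simp: children_def)

lemma children_subset: "children T r u \<subseteq> pverts T"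
  using children_submem_nbhd_iff T.in_arcsD2 by (fastforce simp: mem_nbhd_iff)

lemma finite_children: "finite (children T r u)"
  using children_subset T.pair_finite_verts finite_subset by blast

lemma root_not_child: "r \<notin> children T r u"
proof
  assume "r \<in> children T r u"
  then obtain q where "vpath q (with_proj T)" "hd q = r" "r \<notin> set q"
    by (rule child_on_root_path)
  then show False
    by (cases q) (auto simp: vpath_def vwalk_def)
qed

lemma not_own_child: "u \<notin> children T r u"
  using T.no_loops' by (fastforce simp: children_def mem_nbhd_iff)

lemma card_children_le:
  assumes "u \<in> pverts T"
  shows "card (children T r u) \<le> max_degree T"
proof -
  have "finite (nbhd T u)"
    using T.pair_finite_verts T.in_arcsD2 by (auto simp: mem_nbhd_iff intro!: finite_subset[of "nbhd T u" "pverts T"])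
  then have "card (children T r u) \<le> card (nbhd T u)"
    using children_submem_nbhd_iff card_mono by blast
  also have "\<dots> \<le> max_degree T"
    unfolding max_degree_def out_degree_eq_card_nbhd[symmetric]
    using assms T.pair_finite_verts by (intro Max_ge) auto
  finally show ?thesis .
qed

lemma sum_card_children_le: "(\<Sum>u\<in>pverts T. card (children T r u)) \<le> card (pverts T)"
proof -
  have "(\<Sum>u\<in>pverts T. card (children T r u)) = card (\<Union>u\<in>pverts T. children T r u)"
    using T.pair_finite_verts finite_children parent_unique
    by (intro card_UN_disjoint[symmetric]) blast+
  also have "\<dots> \<le> card (pverts T)"
    using children_subset T.pair_finite_verts by (intro card_mono) auto
  finally show ?thesis .
qed

text \<open>A root path to a vertex outside \<open>E\<close> must leave \<open>E\<close> somewhere.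
  This keeps the algorithm from getting stuck before \<open>T\<close> is complete.\<close>

lemma frontier_exists:
  assumes "r \<in> E" "E \<subset> pverts T"
  shows "\<exists>u\<in>E. \<not> children T r u \<subseteq> E"
proof -
  obtain w where w: "w \<in> pverts T" "w \<notin> E" using assms by blast
  have "\<exists>u\<in>E. \<exists>c. c \<in> children T r u \<and> c \<notin> E"
    if "vpath p (with_proj T)" "hd p = r" "last p \<notin> E" for p
    using that
  proof (induction p rule: rev_induct)
    case Nil
    then show ?case by (simp add: vpath_def vwalk_def)
  next
    case (snoc x xs)
    show ?case
    proof (cases "xs = []")
      case True
      then show ?thesis using snoc.prems assms by auto
    next
      case False
      have vp: "vpath xs (with_proj T)" "hd xs = r"
        using snoc.prems False vwalkI_append_l[of xs "[x]" "with_proj T"] by (auto simp: vpath_def)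
      show ?thesis
      proof (cases "last xs \<in> E")
        case True
        have "(last xs, x) \<in> parcs T"
          using snoc.prems set_vwalk_arcs_snoc[OF False, of x] by (auto simp: vpath_def vwalk_def)
        moreover have "last xs \<in> set (xs @ [x])" using False by simp
        ultimately have "x \<in> children T r (last xs)"
          unfolding children_def mem_nbhd_iff using snoc.prems by force
        then show ?thesis using True snoc.prems by auto
      next
        case False
        then show ?thesis using snoc.IH vp by blast
      qed
    qed
  qed
  then show ?thesis
    using vpath_exists[OF root w(1)] w(2) by (metis subsetD)
qed

end

section \<open>Codegrees in graphs without a complete bipartite subgraph\<close>

text \<open>Together with \<open>A\<close>, any \<open>s\<close> common neighbours would span a
  complete bipartite subgraph; the two sides are disjoint because \<open>G\<close> has no
  loops.\<close>

lemma card_common_nbhd_less: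
  assumes G: "pair_graph G" and free: "bipartite_free s t G"
    and A: "A \<subseteq> pverts G" "card A = t" "t > 0"
  shows "card {v. A \<subseteq> nbhd G v} < s"
proof (rule ccontr)
  interpret G: pair_graph G by (rule G)
  assume "\<not> ?thesis"
  then obtain U where U: "U \<subseteq> {v. A \<subseteq> nbhd G v}" "card U = s"
    using obtain_subset_with_card_n by (metis not_less)
  have arcs: "(u, a) \<in> parcs G" "(a, u) \<in> parcs G" if "u \<in> U" "a \<in> A" for u a
  proof -
    have "a \<in> nbhd G u" using that U by blast
    then show "(u, a) \<in> parcs G" by (simp add: mem_nbhd_iff)
    then show "(a, u) \<in> parcs G"
      using G.pair_sym_arcs arcs_ends_symmetric[of "with_proj G" u a] by simp
  qed
  have "A \<noteq> {}" using A by auto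
  then have sub: "U \<subseteq> pverts G" using arcs G.in_arcsD1 by blast
  define H where "H = \<lparr>pverts = U \<union> A, parcs = U \<times> A \<union> A \<times> U\<rparr>"
  have "U \<inter> A = {}" using arcs G.no_loops' by blast
  then have "complete_bipartite_digraph s t (with_proj H)"
    using U A sub finite_subset[OF _ G.pair_finite_verts]
    unfolding complete_bipartite_digraph_pair_def by (auto simp: H_def)
  moreover from this interpret H: pair_graph H by (rule pair_graphI_complete_bipartite)
  have "subgraph (with_proj H) (with_proj G)"
    using sub A arcs G.wf_digraph H.wf_digraph by (auto simp: subgraph_def compatible_def H_def)
  ultimately show False using free unfolding bipartite_free_def by blast
qed

text \<open>Jensen's inequality for the convex function \<open>x ^ k\<close> on the nonnegative
  reals, with equal weights.\<close>

lemma power_sum_le: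
  fixes h :: "'x \<Rightarrow> real"
  assumes X: "finite X" and h: "\<And>x. x \<in> X \<Longrightarrow> 0 \<le> h x" and k: "k > 0"
  shows "(\<Sum>x\<in>X. h x) ^ k \<le> real (card X) ^ (k - 1) * (\<Sum>x\<in>X. h x ^ k)"
proof (cases "X = {}")
  case True
  then show ?thesis using k by (simp add: zero_power)
next
  case False
  let ?c = "real (card X)"
  have c: "?c > 0" using False X by (simp add: card_gt_0_iff)
  have "convex_on {0..} (\<lambda>x::real. x ^ k)"
    by (cases "even k") (auto intro: convex_power_odd convex_on_subset[OF convex_power_even])
  then have "(\<Sum>x\<in>X. (1 / ?c) *\<^sub>R h x) ^ k \<le> (\<Sum>x\<in>X. (1 / ?c) * h x ^ k)"
    using X False h c by (intro convex_on_sum) auto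
  then have "((\<Sum>x\<in>X. h x) / ?c) ^ k \<le> (\<Sum>x\<in>X. h x ^ k) / ?c"
    by (simp add: sum_divide_distrib)
  then have "(\<Sum>x\<in>X. h x) ^ k \<le> ?c ^ k * ((\<Sum>x\<in>X. h x ^ k) / ?c)"
    using c by (simp add: power_divide field_simps)
  also have "\<dots> = ?c ^ (k - 1) * (\<Sum>x\<in>X. h x ^ k)"
    using c k by (simp add: power_eq_if)
  finally show ?thesis .
qed

text \<open>The right side is the falling factorial, whose factors \<open>n - j\<close> with
  \<open>j < k\<close> are all at least \<open>n + 1 - k\<close>. For \<open>n < k\<close> the
  truncated base is 0 and \<open>k > 0\<close> makes the left side vanish.\<close>

lemma power_le_binomial_fact:
  fixes n k :: nat
  assumes "k > 0"
  shows "(n + 1 - k) ^ k \<le> (n choose k) * fact k"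
proof -
  have step: "(n choose Suc j) * fact (Suc j) = (n choose j) * fact j * (n - j)" for j
  proof -
    have "Suc j * (n choose Suc j) = (n - j) * (n choose j)"
      by (metis binomial_absorb_comp binomial_absorption)
    then show ?thesis
      by (simp only: fact_Suc of_nat_id) (metis mult.assoc mult.commute)
  qed
  have "(n + 1 - k) ^ j \<le> (n choose j) * fact j" if "j \<le> k" for j
    using that
  proof (induction j)
    case (Suc j)
    then have "(n + 1 - k) ^ j * (n + 1 - k) \<le> (n choose j) * fact j * (n - j)"
      by (intro mult_mono) auto
    then show ?case by (simp only: step power_Suc2)
  qed simp
  then show ?thesis by simp
qed

text \<open>The double counting of Kovari, Sos and Turan: pairs of an \<open>x\<close> and a
  \<open>k\<close>-subset of \<open>W\<close> whose sets all contain \<open>x\<close>, combined with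
  convexity.\<close>

lemma sum_card_Int_le:
  fixes N :: "'w \<Rightarrow> 'x set" and \<alpha> :: real
  assumes fin: "finite X" "finite W" and k: "k > 0"
    and few: "\<And>B. B \<subseteq> W \<Longrightarrow> card B = k \<Longrightarrow> card {x \<in> X. \<forall>w\<in>B. x \<in> N w} \<le> s"
    and \<alpha>: "\<alpha> \<ge> 0" "\<alpha> ^ k = real s * real (card X) ^ (k - 1)"
  shows "(\<Sum>w\<in>W. real (card (X \<inter> N w))) \<le> real (k - 1) * real (card X) + \<alpha> * real (card W)"
proof -
  define g where "g x = card {w \<in> W. x \<in> N w}" for x
  \<comment> \<open>The excess of \<open>g x\<close> over \<open>k - 1\<close>, truncated at 0.
    Hence \<open>g x \<le> (k - 1) + h x\<close> always holds, and the summands \<open>k - 1\<close>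
    yield the first term of the bound.\<close>
  define h where "h x = g x + 1 - k" for x
  have swap: "(\<Sum>w\<in>W. card (X \<inter> N w)) = (\<Sum>x\<in>X. g x)"
    unfolding g_def using sum_multicount_gen[OF fin(2,1), of "\<lambda>w x. x \<in> N w" "\<lambda>x. card {w \<in> W. x \<in> N w}"]
    by (simp add: Int_def)
  let ?S = "{B. B \<subseteq> W \<and> card B = k}"
  have finS: "finite ?S" using fin by simp
  have "(\<Sum>x\<in>X. g x choose k) = (\<Sum>x\<in>X. card {B \<in> ?S. \<forall>w\<in>B. x \<in> N w})"
  proof (rule sum.cong)
    fix x
    have "{B \<in> ?S. \<forall>w\<in>B. x \<in> N w} = {B. B \<subseteq> {w \<in> W. x \<in> N w} \<and> card B = k}" by auto
    then show "g x choose k = card {B \<in> ?S. \<forall>w\<in>B. x \<in> N w}"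
      using fin n_subsets[of "{w \<in> W. x \<in> N w}" k] by (simp add: g_def)
  qed simp
  also have "\<dots> = (\<Sum>B\<in>?S. card {x \<in> X. \<forall>w\<in>B. x \<in> N w})"
    using sum_multicount_gen[OF fin(1) finS, of "\<lambda>x B. \<forall>w\<in>B. x \<in> N w" "\<lambda>B. card {x \<in> X. \<forall>w\<in>B. x \<in> N w}"]
    by simp
  also have "\<dots> \<le> (\<Sum>B\<in>?S. s)"
    by (intro sum_mono few) auto
  also have "\<dots> = (card W choose k) * s"
    using n_subsets[OF fin(2), of k] by simp
  finally have binom: "(\<Sum>x\<in>X. g x choose k) \<le> (card W choose k) * s" .
  have "(\<Sum>x\<in>X. h x ^ k) \<le> (\<Sum>x\<in>X. (g x choose k) * fact k)"
    unfolding h_def using power_le_binomial_fact[OF k] by (intro sum_mono) auto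
  also have "\<dots> = (\<Sum>x\<in>X. g x choose k) * fact k"
    by (simp add: sum_distrib_right)
  also have "\<dots> \<le> (card W choose k) * s * fact k"
    using binom by simp
  also have "\<dots> = (card W choose k) * fact k * s" by simp
  also have "\<dots> \<le> card W ^ k * s"
    using binomial_fact_pow by (intro mult_right_mono) auto
  finally have hk: "(\<Sum>x\<in>X. h x ^ k) \<le> card W ^ k * s" .
  have "(\<Sum>x\<in>X. real (h x)) ^ k \<le> real (card X) ^ (k - 1) * (\<Sum>x\<in>X. real (h x) ^ k)"
    using fin k by (intro power_sum_le) auto
  also have "(\<Sum>x\<in>X. real (h x) ^ k) = real (\<Sum>x\<in>X. h x ^ k)" by simp
  also have "real (card X) ^ (k - 1) * real (\<Sum>x\<in>X. h x ^ k) \<le> real (card X) ^ (k - 1) * real (card W ^ k * s)"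
    using hk by (intro mult_left_mono) (simp_all only: of_nat_le_iff, simp)
  also have "\<dots> = (\<alpha> * card W) ^ k"
    using \<alpha> by (simp add: power_mult_distrib mult_ac)
  finally have "(\<Sum>x\<in>X. real (h x)) \<le> \<alpha> * card W"
    using k \<alpha> by (meson mult_nonneg_nonneg of_nat_0_le_iff power_mono_iff sum_nonneg)
  moreover have "(\<Sum>x\<in>X. real (g x)) \<le> (\<Sum>x\<in>X. real (k - 1) + real (h x))"
    using k by (intro sum_mono) (auto simp: h_def)
  moreover have "(\<Sum>w\<in>W. real (card (X \<inter> N w))) = (\<Sum>x\<in>X. real (g x))"
    using swap by (metis of_nat_sum)
  ultimately show ?thesis
    by (simp add: sum.distrib mult.commute)
qed

section \<open>An exponential potential\<close>

text \<open>\<open>x ^ k * exp (- c)\<close> is the usual exponential supermartingale for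
  \<open>k\<close> hits with compensator \<open>c\<close>. It is switched on only at hit number
  \<open>\<tau>\<close>, and the price \<open>x ^ \<tau>\<close> of entering is deducted.\<close>

definition gain :: "real \<Rightarrow> nat \<Rightarrow> nat \<Rightarrow> real \<Rightarrow> real" where
  "gain x \<tau> k c = (if k < \<tau> then 0 else x ^ k * exp (- c) - x ^ \<tau>)"

text \<open>
  \<open>L\<close> bounds the number of indices that ever reach \<open>\<tau>\<close> hits, so the term \<open>L x\<^sup>\<tau>\<close> prepays the
  value \<open>x\<^sup>\<tau>\<close> at which an index starts to count.
\<close>

definition potential :: "real \<Rightarrow> nat \<Rightarrow> real \<Rightarrow> 'v set \<Rightarrow> ('v \<Rightarrow> nat) \<Rightarrow> ('v \<Rightarrow> real) \<Rightarrow> real" where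
  "potential x \<tau> L V k c = L * x ^ \<tau> + (\<Sum>v\<in>V. gain x \<tau> (k v) (c v))"

text \<open>One random choice \<open>y\<close> from \<open>X\<close>, with hit set \<open>S\<close>.
  An index short of \<open>\<tau>\<close> can at best enter, at a value that is at most 0 since
  \<open>exp (- c') \<le> 1\<close>. For an index already counting, \<open>1 + z \<le> exp z\<close>
  shows that the growth of the compensator outweighs the expected factor.\<close>

lemma sum_gain_le:
  assumes x: "x \<ge> 1" and X: "finite X" "X \<noteq> {}" and c: "c' \<ge> 0"
    and le: "c + (x - 1) * (card (X \<inter> S) / card X) \<le> c'"
  shows "(\<Sum>y\<in>X. gain x \<tau> (k + (if y \<in> S then 1 else 0)) c') \<le> card X * gain x \<tau> k c"
proof (cases "k < \<tau>")
  case True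
  have "gain x \<tau> j c' \<le> 0" if "j \<le> Suc k" for j
  proof (cases "j < \<tau>")
    case False
    then have "j = \<tau>" using that True by simp
    then show ?thesis using x c by (simp add: gain_def mult_left_le)
  qed (simp add: gain_def)
  then have "(\<Sum>y\<in>X. gain x \<tau> (k + (if y \<in> S then 1 else 0)) c') \<le> 0"
    by (intro sum_nonpos) auto
  then show ?thesis using True by (simp add: gain_def)
next
  case False
  define p where "p = card (X \<inter> S) / card X"
  have cX: "real (card X) > 0" using X by (simp add: card_gt_0_iff)
  have "(\<Sum>y\<in>X. gain x \<tau> (k + (if y \<in> S then 1 else 0)) c')
      = (\<Sum>y\<in>X. x ^ k * exp (- c') * (1 + (if y \<in> S then x - 1 else 0)) - x ^ \<tau>)"
    using False by (intro sum.cong) (auto simp: gain_def algebra_simps)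
  also have "\<dots> = x ^ k * exp (- c') * (card X + (x - 1) * card (X \<inter> S)) - card X * x ^ \<tau>"
    using X by (simp add: sum_subtractf sum_distrib_left[symmetric] sum.distrib sum.If_cases algebra_simps)
  also have "\<dots> = card X * (x ^ k * (exp (- c') * (1 + (x - 1) * p)) - x ^ \<tau>)"
    using cX by (simp add: p_def field_simps)
  also have "\<dots> \<le> card X * (x ^ k * exp (- c) - x ^ \<tau>)"
  proof -
    have "exp (- c') * (1 + (x - 1) * p) \<le> exp (- c') * exp ((x - 1) * p)"
      by (intro mult_left_mono) (simp_all add: exp_ge_add_one_self)
    also have "\<dots> = exp ((x - 1) * p - c')" by (simp add: exp_add[symmetric] exp_diff exp_minus field_simps)
    also have "\<dots> \<le> exp (- c)" using le by (simp add: p_def)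
    finally show ?thesis using x cX by (intro mult_left_mono diff_right_mono) auto
  qed
  finally show ?thesis using False by (simp add: gain_def)
qed

lemma sum_potential_le:
  assumes "x \<ge> 1" "finite X" "X \<noteq> {}" "\<And>v. v \<in> V \<Longrightarrow> c' v \<ge> 0"
    and "\<And>v. v \<in> V \<Longrightarrow> c v + (x - 1) * (card (X \<inter> S v) / card X) \<le> c' v"
    and k': "\<And>v y. v \<in> V \<Longrightarrow> y \<in> X \<Longrightarrow> k' y v = k v + (if y \<in> S v then 1 else 0)"
  shows "(\<Sum>y\<in>X. potential x \<tau> L V (k' y) c') \<le> card X * potential x \<tau> L V k c"
proof -
  have "(\<Sum>y\<in>X. \<Sum>v\<in>V. gain x \<tau> (k' y v) (c' v))
      = (\<Sum>v\<in>V. \<Sum>y\<in>X. gain x \<tau> (k v + (if y \<in> S v then 1 else 0)) (c' v))"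
    by (subst sum.swap) (intro sum.cong, auto simp: k')
  also have "\<dots> \<le> (\<Sum>v\<in>V. card X * gain x \<tau> (k v) (c v))"
    using assms by (intro sum_mono sum_gain_le) auto
  finally show ?thesis
    by (simp add: potential_def sum.distrib sum_distrib_left algebra_simps)
qed

text \<open>At most \<open>L\<close> indices have paid the price \<open>x ^ \<tau>\<close>, so the
  prepaid term covers all deductions.\<close>

lemma sum_active_le_potential:
  fixes x L :: real
  assumes "x \<ge> 0" "finite V" "card {v \<in> V. \<tau> \<le> k v} \<le> L"
  shows "(\<Sum>v | v \<in> V \<and> \<tau> \<le> k v. x ^ k v * exp (- c v)) \<le> potential x \<tau> L V k c"
proof -
  let ?A = "{v \<in> V. \<tau> \<le> k v}"
  have "(\<Sum>v\<in>V. gain x \<tau> (k v) (c v)) = (\<Sum>v\<in>?A. x ^ k v * exp (- c v) - x ^ \<tau>)"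
    using assms by (intro sum.mono_neutral_cong_right) (auto simp: gain_def)
  also have "\<dots> = (\<Sum>v\<in>?A. x ^ k v * exp (- c v)) - card ?A * x ^ \<tau>"
    by (simp add: sum_subtractf)
  finally show ?thesis
    using assms mult_right_mono[OF assms(3), of "x ^ \<tau>"] by (simp add: potential_def)
qed

lemma potential_nonneg:
  fixes x L :: real
  assumes "x \<ge> 0" "finite V" "card {v \<in> V. \<tau> \<le> k v} \<le> L"
  shows "0 \<le> potential x \<tau> L V k c"
  using sum_active_le_potential[OF assms] assms(1)
  by (meson order_trans sum_nonneg mult_nonneg_nonneg zero_le_power exp_ge_zero)

lemma active_le_potential:
  fixes x L :: real
  assumes "x \<ge> 0" "finite V" "card {v \<in> V. \<tau> \<le> k v} \<le> L" "v \<in> V" "\<tau> \<le> k v"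
  shows "x ^ k v * exp (- c v) \<le> potential x \<tau> L V k c"
proof -
  have "x ^ k v * exp (- c v) \<le> (\<Sum>v | v \<in> V \<and> \<tau> \<le> k v. x ^ k v * exp (- c v))"
    using assms by (intro member_le_sum) auto
  then show ?thesis using sum_active_le_potential[OF assms(1-3)] order_trans by blast
qed

text \<open>An index with exactly \<open>\<tau>\<close> hits is still harmless: its gain is
  \<open>x ^ \<tau> * (exp (- c) - 1)\<close>.\<close>

lemma potential_le_initial:
  assumes "x \<ge> 0" "\<And>v. v \<in> V \<Longrightarrow> k v \<le> \<tau>" "\<And>v. v \<in> V \<Longrightarrow> c v \<ge> 0"
  shows "potential x \<tau> L V k c \<le> L * x ^ \<tau>"
proof -
  have "gain x \<tau> (k v) (c v) \<le> 0" if "v \<in> V" for v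
    using assms(2,3)[OF that] assms(1) by (cases "k v = \<tau>") (auto simp: gain_def mult_left_le)
  then show ?thesis by (simp add: potential_def sum_nonpos)
qed

section \<open>The potential of a partial embedding\<close>

text \<open>The number \<open>\<alpha>\<close> enters through its power because this is the form
  that the double counting needs for a set of \<open>d\<close> vertices and
  \<open>k = t - 1\<close>. The last assumption amounts to \<open>xheavy \<ge> 1\<close>, and
  \<open>d \<ge> 2 * t\<close> ensures that a vertex with \<open>d / 2\<close> hits already counts
  in the potential.\<close>

locale greedy_embedding = rooted_tree T r
  for T :: "'a pair_pre_digraph" and r :: 'a +
  fixes G :: "'b pair_pre_digraph" and Nplus :: "'b \<Rightarrow> 'b set" and s t d :: nat and \<alpha> :: real
  assumes pair_graph_G: "pair_graph G" and free: "bipartite_free s t G"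
    and Nplus_subset: "v \<in> pverts G \<Longrightarrow> Nplus v \<subseteq> nbhd G v"
    and card_Nplus: "v \<in> pverts G \<Longrightarrow> card (Nplus v) = d"
    and t_ge_2: "t \<ge> 2" and d_ge: "d \<ge> 2 * t"
    and \<alpha>_pos: "\<alpha> > 0" and \<alpha>_power: "\<alpha> ^ (t - 1) = real s * real d ^ (t - 2)"
    and card_T: "64 * \<alpha> * card (pverts T) \<le> (real d)\<^sup>2"
    and degree_T: "256 * max_degree T \<le> d"
    and \<alpha>_large: "t \<ge> 4 \<Longrightarrow> 4 * (real t - 1)\<^sup>2 * d \<le> \<alpha>\<^sup>2"
begin

sublocale G: pair_graph G
  by (rule pair_graph_G)

lemma parcs_G_sym: "(u, v) \<in> parcs G \<Longrightarrow> (v, u) \<in> parcs G"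
  using G.pair_sym_arcs arcs_ends_symmetric by fastforce

lemma d_pos: "d > 0"
  using t_ge_2 d_ge by simp

lemma Nplus_verts: "v \<in> pverts G \<Longrightarrow> Nplus v \<subseteq> pverts G"
  using Nplus_subset G.in_arcsD2 by (fastforce simp: mem_nbhd_iff)

lemma finite_Nplus: "v \<in> pverts G \<Longrightarrow> finite (Nplus v)"
  using Nplus_verts G.pair_finite_verts finite_subset by blast

section \<open>Codegrees, close vertices and heavy tree vertices\<close>

definition codeg :: "'b \<Rightarrow> 'b \<Rightarrow> nat" where
  "codeg v w = card (Nplus v \<inter> Nplus w)"

text \<open>The threshold is twice \<open>\<alpha>\<close> so that the linear term of
  \<open>sum_codeg_le\<close> can be absorbed when it is applied to the close vertices
  themselves.\<close>

definition close :: "'b \<Rightarrow> 'b set" where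
  "close v = {w \<in> pverts G. 2 * \<alpha> \<le> codeg v w}"

text \<open>A light vertex has at most \<open>d / (128 (t - 1))\<close> children. Multiplied by the
  total codegree \<open>2 (t - 1) d\<close> of the close vertices, this is only
  \<open>d\<^sup>2 / 64\<close>, written \<open>d^2 / 64\<close> below.\<close>

definition heavy :: "'a set" where
  "heavy = {u \<in> pverts T. d \<le> 128 * (t - 1) * card (children T r u)}"

definition wmax :: real where
  "wmax = (real t - 1) * d / \<alpha>"

lemma close_subset: "close v \<subseteq> pverts G"
  by (auto simp: close_def)

lemma finite_close: "finite (close v)"
  using close_subset G.pair_finite_verts finite_subset by blast

lemma codeg_le: "v \<in> pverts G \<Longrightarrow> codeg v w \<le> d"
  unfolding codeg_def using card_mono[OF finite_Nplus] card_Nplus by (metis Int_lower1)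

lemma wmax_pos: "wmax > 0"
  using t_ge_2 d_pos \<alpha>_pos by (simp add: wmax_def)

lemma finite_common_nbhd:
  assumes "A \<noteq> {}"
  shows "finite {v. A \<subseteq> nbhd G v}"
proof (rule finite_subset[OF _ G.pair_finite_verts])
  obtain a where "a \<in> A" using assms by blast
  then have "(v, a) \<in> parcs G" if "A \<subseteq> nbhd G v" for v
    using that by (auto simp: mem_nbhd_iff[symmetric])
  then show "{v. A \<subseteq> nbhd G v} \<subseteq> pverts G" using G.in_arcsD1 by blast
qed

lemma card_common_nbhd_le:
  assumes "A \<subseteq> pverts G" "card A = t"
  shows "card {v. A \<subseteq> nbhd G v} \<le> s"
  using card_common_nbhd_less[OF pair_graph_G free assms] t_ge_2 by simp

text \<open>Any \<open>t - 1\<close> vertices other than \<open>v\<close> form with \<open>v\<close>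
  a set of \<open>t\<close> vertices, so double counting applies inside \<open>Nplus v\<close> with
  \<open>k = t - 1\<close>. If \<open>v\<close> itself lies in \<open>W\<close>, it is split off at
  a cost of at most \<open>d\<close>, which turns \<open>t - 2\<close> into
  \<open>t - 1\<close>.\<close>

lemma sum_codeg_le:
  assumes v: "v \<in> pverts G" and W: "W \<subseteq> pverts G"
  shows "(\<Sum>w\<in>W. real (codeg v w)) \<le> (real t - 1) * d + \<alpha> * card W"
proof -
  have finW: "finite W" using W G.pair_finite_verts finite_subset by blast
  have off: "(\<Sum>w\<in>W'. real (codeg v w)) \<le> (real t - 2) * d + \<alpha> * card W'"
    if W': "W' \<subseteq> W" "v \<notin> W'" for W'
  proof -
    have few: "card {x \<in> Nplus v. \<forall>w\<in>B. x \<in> Nplus w} \<le> s" if B: "B \<subseteq> W'" "card B = t - 1" for B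
    proof -
      have B': "finite B" "v \<notin> B" "insert v B \<subseteq> pverts G"
        using B W' W v finite_subset[OF _ finW] by auto
      then have c: "card (insert v B) = t" using B t_ge_2 by simp
      have "x \<in> {x. insert v B \<subseteq> nbhd G x}" if "x \<in> Nplus v" "\<forall>w\<in>B. x \<in> Nplus w" for x
        using that B' Nplus_subset parcs_G_sym by (fastforce simp: mem_nbhd_iff)
      then have "card {x \<in> Nplus v. \<forall>w\<in>B. x \<in> Nplus w} \<le> card {x. insert v B \<subseteq> nbhd G x}"
        by (intro card_mono finite_common_nbhd) auto
      then show ?thesis using card_common_nbhd_le[OF B'(3) c] by simp
    qed
    have "(\<Sum>w\<in>W'. real (card (Nplus v \<inter> Nplus w))) \<le> real (t - 1 - 1) * real (card (Nplus v)) + \<alpha> * card W'"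
      using W' finW \<alpha>_pos \<alpha>_power t_ge_2 few
      by (intro sum_card_Int_le[where s = s] finite_Nplus v)
         (auto simp: card_Nplus[OF v] numeral_2_eq_2 intro: finite_subset)
    then show ?thesis
      using t_ge_2 by (simp add: codeg_def card_Nplus[OF v] of_nat_diff)
  qed
  show ?thesis
  proof (cases "v \<in> W")
    case True
    have "(\<Sum>w\<in>W. real (codeg v w)) = codeg v v + (\<Sum>w\<in>W - {v}. real (codeg v w))"
      using True finW by (simp add: sum.remove)
    also have "\<dots> \<le> d + ((real t - 2) * d + \<alpha> * card (W - {v}))"
      using off[of "W - {v}"] codeg_le[OF v, of v] by simp
    also have "\<dots> \<le> d + ((real t - 2) * d + \<alpha> * card W)"
      using finW \<alpha>_pos by (auto intro!: mult_left_mono card_mono)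
    finally show ?thesis by (simp add: algebra_simps)
  next
    case False
    then show ?thesis using off[of W] by (simp add: algebra_simps)
  qed
qed

text \<open>Both bounds come from comparing \<open>2 \<alpha> |close v|\<close> with the upper bound
  \<open>(t - 1) d + \<alpha> |close v|\<close> for the same sum.\<close>

lemma
  assumes v: "v \<in> pverts G"
  shows card_close_le: "card (close v) \<le> wmax"
    and sum_codeg_close_le: "(\<Sum>w\<in>close v. real (codeg v w)) \<le> 2 * (real t - 1) * d"
proof -
  have "(\<Sum>w\<in>close v. 2 * \<alpha>) \<le> (\<Sum>w\<in>close v. real (codeg v w))"
    by (intro sum_mono) (auto simp: close_def)
  moreover have "(\<Sum>w\<in>close v. real (codeg v w)) \<le> (real t - 1) * d + \<alpha> * card (close v)"
    by (intro sum_codeg_le v) (auto simp: close_def)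
  ultimately have *: "\<alpha> * card (close v) \<le> (real t - 1) * d"
    by (simp add: algebra_simps)
  then show "card (close v) \<le> wmax"
    using \<alpha>_pos by (simp add: wmax_def field_simps)
  show "(\<Sum>w\<in>close v. real (codeg v w)) \<le> 2 * (real t - 1) * d"
    using * sum_codeg_le[of v "close v"] v by (simp add: close_subset algebra_simps)
qed

text \<open>The children sets are disjoint, so heavy vertices number at most
  \<open>128 (t - 1) |T| / d\<close>; the size bound on \<open>T\<close> turns this into
  \<open>2 (t - 1) d / \<alpha>\<close>.\<close>

lemma card_heavy_le: "card heavy \<le> 2 * wmax"
proof -
  have fin: "finite (pverts T)" by (rule T.pair_finite_verts)
  have "card heavy * d \<le> (\<Sum>u\<in>heavy. 128 * (t - 1) * card (children T r u))"
    using sum_mono[of heavy "\<lambda>_. d"] by (simp add: heavy_def)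
  also have "\<dots> \<le> (\<Sum>u\<in>pverts T. 128 * (t - 1) * card (children T r u))"
    using fin by (intro sum_mono2) (auto simp: heavy_def)
  also have "\<dots> \<le> 128 * (t - 1) * card (pverts T)"
    using sum_card_children_le by (simp add: sum_distrib_left[symmetric])
  finally have "real (card heavy * d) \<le> real (128 * (t - 1) * card (pverts T))"
    by (simp only: of_nat_le_iff)
  then have "\<alpha> * (card heavy * real d) \<le> \<alpha> * (128 * (real t - 1) * card (pverts T))"
    using \<alpha>_pos t_ge_2 by (intro mult_left_mono) (auto simp: of_nat_diff)
  also have "\<dots> = 2 * (real t - 1) * (64 * \<alpha> * card (pverts T))" by simp
  also have "\<dots> \<le> 2 * (real t - 1) * (real d)\<^sup>2"
    using card_T t_ge_2 by (intro mult_left_mono) auto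
  finally have "real d * (\<alpha> * card heavy) \<le> real d * (2 * (real t - 1) * d)"
    by (simp add: power2_eq_square mult_ac)
  then have "\<alpha> * card heavy \<le> 2 * (real t - 1) * d"
    using d_pos by (simp only: mult_le_cancel_left_pos of_nat_0_less_iff)
  then show ?thesis
    using \<alpha>_pos by (simp add: wmax_def field_simps)
qed

section \<open>Hits, drifts and the combined potential\<close>

definition partial_embedding :: "'a set \<Rightarrow> ('a \<Rightarrow> 'b) \<Rightarrow> bool" where
  "partial_embedding E f \<longleftrightarrow> r \<in> E \<and> E \<subseteq> pverts T \<and> inj_on f E \<and> f ` E \<subseteq> pverts G \<and>
     (\<forall>u c. c \<in> children T r u \<longrightarrow> c \<in> E \<longrightarrow> u \<in> E \<and> f c \<in> Nplus (f u))"

definition hits :: "'a set \<Rightarrow> ('a \<Rightarrow> 'b) \<Rightarrow> 'b \<Rightarrow> nat" where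
  "hits E f v = card {w \<in> E. f w \<in> Nplus v}"

text \<open>Only children already placed are counted, which makes this the compensator accrued so
  far rather than its final value.\<close>

definition drift :: "'a set \<Rightarrow> ('a \<Rightarrow> 'b) \<Rightarrow> 'b \<Rightarrow> real" where
  "drift E f v = (\<Sum>u\<in>E. card (children T r u \<inter> E) * (2 * codeg v (f u) / d))"

definition heavy_hits :: "'a set \<Rightarrow> ('a \<Rightarrow> 'b) \<Rightarrow> 'b \<Rightarrow> nat" where
  "heavy_hits E f v = card {w \<in> E \<inter> heavy. f w \<in> close v}"

text \<open>One rate serves all \<open>v\<close>, since no vertex has more than \<open>wmax\<close>
  close vertices. By \<open>card_heavy_le\<close> the total never exceeds 1.\<close>

definition heavy_drift :: "'a set \<Rightarrow> real" where
  "heavy_drift E = card (E \<inter> heavy) / (2 * wmax)"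

text \<open>The solution of \<open>xheavy * (2 * wmax / d) = 1 / (2 * wmax)\<close>: the largest
  base, up to lower order, that one increment of \<open>heavy_drift\<close> pays for.\<close>

definition xheavy :: real where
  "xheavy = \<alpha>\<^sup>2 / (4 * (real t - 1)\<^sup>2 * d)"

abbreviation "hit_limit \<equiv> real (s * card (pverts T) ^ t)"

abbreviation "hit_potential E f \<equiv>
  potential 2 t hit_limit (pverts G) (hits E f) (drift E f)"

abbreviation "heavy_potential E f \<equiv>
  potential xheavy 1 (2 * wmax\<^sup>2) (pverts G) (heavy_hits E f) (\<lambda>_. heavy_drift E)"

text \<open>The weights make either summand reach 1 at a bad event. With \<open>d / 2\<close> hits
  and drift at most \<open>d / 8\<close>, the hit potential is at least
  \<open>exp (d / 4 - d / 8)\<close>; with five heavy hits and heavy drift at most 1, the heavy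
  potential is at least \<open>xheavy ^ 5 / exp 1\<close>.\<close>

definition Psi :: "'a set \<Rightarrow> ('a \<Rightarrow> 'b) \<Rightarrow> real" where
  "Psi E f = exp (- real d / 8) * hit_potential E f +
     (if t \<ge> 4 then exp 1 / xheavy ^ 5 * heavy_potential E f else 0)"

lemma xheavy_ge_1: "t \<ge> 4 \<Longrightarrow> xheavy \<ge> 1"
  using \<alpha>_large d_pos t_ge_2 by (simp add: xheavy_def)

lemma xheavy_pos: "xheavy > 0"
  using \<alpha>_pos d_pos t_ge_2 by (simp add: xheavy_def)

section \<open>Counting the active vertices, and what a potential below 1 guarantees\<close>

context
  fixes E :: "'a set" and f :: "'a \<Rightarrow> 'b"
  assumes PE: "partial_embedding E f"
begin

lemma finite_E: "finite E"
  using PE T.pair_finite_verts finite_subset unfolding partial_embedding_def by blast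

lemma f_verts: "u \<in> E \<Longrightarrow> f u \<in> pverts G"
  using PE unfolding partial_embedding_def by blast

lemma hits_eq: "hits E f v = card (Nplus v \<inter> f ` E)"
proof -
  have "Nplus v \<inter> f ` E = f ` {w \<in> E. f w \<in> Nplus v}" by blast
  moreover have "inj_on f {w \<in> E. f w \<in> Nplus v}"
    using PE by (auto simp: partial_embedding_def intro: inj_on_subset)
  ultimately show ?thesis by (simp add: hits_def card_image)
qed

text \<open>A vertex with \<open>t\<close> hits is a common neighbour of some
  \<open>t\<close>-subset of the image, and each such subset has at most \<open>s\<close> common
  neighbours. The order of \<open>G\<close> does not enter.\<close>

lemma card_hit_le: "card {v \<in> pverts G. t \<le> hits E f v} \<le> hit_limit"
proof -
  let ?S = "{A. A \<subseteq> f ` E \<and> card A = t}"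
  have finS: "finite ?S" using finite_E by simp
  have ne: "A \<noteq> {}" if "A \<in> ?S" for A using that t_ge_2 by auto
  have "{v \<in> pverts G. t \<le> hits E f v} \<subseteq> (\<Union>A\<in>?S. {v. A \<subseteq> nbhd G v})"
  proof
    fix v assume "v \<in> {v \<in> pverts G. t \<le> hits E f v}"
    then have v: "v \<in> pverts G" "t \<le> card (Nplus v \<inter> f ` E)" by (auto simp: hits_eq)
    then obtain A where "A \<subseteq> Nplus v \<inter> f ` E" "card A = t"
      using obtain_subset_with_card_n by metis
    then show "v \<in> (\<Union>A\<in>?S. {v. A \<subseteq> nbhd G v})"
      using Nplus_subset[OF v(1)] by blast
  qed
  then have "card {v \<in> pverts G. t \<le> hits E f v} \<le> card (\<Union>A\<in>?S. {v. A \<subseteq> nbhd G v})"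
    using finS ne by (intro card_mono finite_UN_I finite_common_nbhd) auto
  also have "\<dots> \<le> (\<Sum>A\<in>?S. card {v. A \<subseteq> nbhd G v})"
    using finS by (rule card_UN_le)
  also have "\<dots> \<le> (\<Sum>A\<in>?S. s)"
    using PE by (intro sum_mono card_common_nbhd_le) (auto simp: partial_embedding_def)
  also have "\<dots> = s * (card (f ` E) choose t)"
    using n_subsets[of "f ` E" t] finite_E by simp
  also have "\<dots> \<le> s * card (pverts T) ^ t"
  proof -
    have "card (f ` E) \<le> card (pverts T)"
      using card_image_le[OF finite_E, of f] PE card_mono[OF T.pair_finite_verts, of E]
      by (simp add: partial_embedding_def)
    then have "card (f ` E) choose t \<le> card (pverts T) ^ t"
      by (cases "t \<le> card (f ` E)")
         (auto intro: order_trans[OF binomial_le_pow power_mono] simp: binomial_eq_0)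
    then show ?thesis by simp
  qed
  finally show ?thesis by (simp only: of_nat_le_iff)
qed

text \<open>By symmetry of closeness, a vertex with a heavy hit is close to the image of a heavy
  vertex: at most \<open>2 * wmax\<close> images with at most \<open>wmax\<close> close vertices
  each.\<close>

lemma card_heavy_hit_le: "card {v \<in> pverts G. 1 \<le> heavy_hits E f v} \<le> 2 * wmax\<^sup>2"
proof -
  have "{v \<in> pverts G. 1 \<le> heavy_hits E f v} \<subseteq> (\<Union>u\<in>E \<inter> heavy. close (f u))"
  proof
    fix v assume "v \<in> {v \<in> pverts G. 1 \<le> heavy_hits E f v}"
    then have v: "v \<in> pverts G" "{w \<in> E \<inter> heavy. f w \<in> close v} \<noteq> {}"
      unfolding heavy_hits_def by (blast, metis (lifting) card.empty mem_Collect_eq not_one_le_zero)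
    then show "v \<in> (\<Union>u\<in>E \<inter> heavy. close (f u))"
      by (auto simp: close_def codeg_def Int_commute)
  qed
  then have "card {v \<in> pverts G. 1 \<le> heavy_hits E f v} \<le> card (\<Union>u\<in>E \<inter> heavy. close (f u))"
    using finite_E by (intro card_mono finite_UN_I finite_close) auto
  also have "\<dots> \<le> (\<Sum>u\<in>E \<inter> heavy. card (close (f u)))"
    using finite_E by (intro card_UN_le) auto
  finally have "real (card {v \<in> pverts G. 1 \<le> heavy_hits E f v}) \<le> real (\<Sum>u\<in>E \<inter> heavy. card (close (f u)))"
    by (simp only: of_nat_le_iff)
  also have "\<dots> \<le> (\<Sum>u\<in>E \<inter> heavy. wmax)"
    unfolding of_nat_sum by (intro sum_mono card_close_le) (auto simp: f_verts)
  also have "\<dots> \<le> card heavy * wmax"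
    using wmax_pos T.pair_finite_verts by (auto simp: heavy_def intro!: card_mono)
  also have "\<dots> \<le> 2 * wmax * wmax"
    using card_heavy_le wmax_pos by (intro mult_right_mono) auto
  finally show ?thesis by (simp add: power2_eq_square)
qed

lemma heavy_drift_le: "heavy_drift E \<le> 1"
proof -
  have "card (E \<inter> heavy) \<le> card heavy"
    using T.pair_finite_verts by (intro card_mono) (auto simp: heavy_def)
  then show ?thesis
    using card_heavy_le wmax_pos by (simp add: heavy_drift_def)
qed

lemma hit_potential_nonneg: "0 \<le> hit_potential E f"
  using card_hit_le G.pair_finite_verts by (intro potential_nonneg) auto

lemma heavy_potential_nonneg: "0 \<le> heavy_potential E f"
  using card_heavy_hit_le xheavy_pos G.pair_finite_verts by (intro potential_nonneg) auto

lemma Psi_nonneg: "0 \<le> Psi E f"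
  using hit_potential_nonneg heavy_potential_nonneg xheavy_pos by (simp add: Psi_def)

lemma heavy_hits_le:
  assumes "Psi E f < 1" "t \<ge> 4" "v \<in> pverts G"
  shows "heavy_hits E f v \<le> 4"
proof (rule ccontr)
  assume "\<not> ?thesis"
  then have k: "heavy_hits E f v \<ge> 5" by simp
  have "xheavy ^ 5 * exp (- 1) \<le> xheavy ^ heavy_hits E f v * exp (- heavy_drift E)"
    using k xheavy_ge_1[OF assms(2)] heavy_drift_le by (intro mult_mono power_increasing) auto
  also have "\<dots> \<le> heavy_potential E f"
    using k assms(3) card_heavy_hit_le xheavy_pos G.pair_finite_verts
    by (intro active_le_potential[where c = "\<lambda>_. heavy_drift E"]) auto
  finally have "1 \<le> exp 1 / xheavy ^ 5 * heavy_potential E f"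
    using xheavy_pos by (simp add: exp_minus field_simps)
  moreover have "0 \<le> exp (- real d / 8) * hit_potential E f"
    using hit_potential_nonneg by simp
  ultimately show False using assms by (simp add: Psi_def)
qed

text \<open>For \<open>t \<ge> 4\<close> at most four terms occur, each at most \<open>d\<close>.
  For \<open>t \<le> 3\<close> the sum over all close vertices is already at most
  \<open>2 (t - 1) d \<le> 4 d\<close>.\<close>

lemma sum_heavy_codeg_le:
  assumes "Psi E f < 1" and v: "v \<in> pverts G"
  shows "(\<Sum>u | u \<in> E \<inter> heavy \<and> f u \<in> close v. real (codeg v (f u))) \<le> 4 * d"
    (is "sum ?g ?U \<le> _")
proof (cases "t \<ge> 4")
  case True
  have "sum ?g ?U \<le> card ?U * real d"
    using sum_bounded_above[of ?U ?g "real d"] codeg_le[OF v] by simp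
  also have "\<dots> \<le> 4 * real d"
    using heavy_hits_le[OF assms(1) True v] by (intro mult_right_mono) (auto simp: heavy_hits_def)
  finally show ?thesis by simp
next
  case False
  have "inj_on f ?U"
    using PE by (auto simp: partial_embedding_def intro: inj_on_subset)
  then have "sum ?g ?U = (\<Sum>w\<in>f ` ?U. real (codeg v w))"
    by (simp add: sum.reindex)
  also have "\<dots> \<le> (\<Sum>w\<in>close v. real (codeg v w))"
    using finite_close by (intro sum_mono2) auto
  also have "\<dots> \<le> 2 * (real t - 1) * d" by (rule sum_codeg_close_le[OF v])
  also have "\<dots> \<le> 4 * real d" using False t_ge_2 by (intro mult_right_mono) auto
  finally show ?thesis by simp
qed

text \<open>The sum of children times codegree splits into \<open>d^2 / 32\<close> from images not
  close to \<open>v\<close> (codegree below \<open>2 \<alpha>\<close>, and few children in all),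
  \<open>d^2 / 64\<close> from light vertices placed close, and \<open>d^2 / 64\<close> from heavy
  ones, which have at most \<open>d / 256\<close> children by the degree bound. The factor
  \<open>2 / d\<close> leaves \<open>d / 8\<close>.\<close>

lemma drift_le:
  assumes "Psi E f < 1" and v: "v \<in> pverts G"
  shows "drift E f v \<le> d / 8"
proof -
  define a where "a u = real (codeg v (f u))" for u
  define n where "n u = real (card (children T r u))" for u
  have a0: "a u \<ge> 0" and n0: "n u \<ge> 0" for u by (auto simp: a_def n_def)
  \<comment> \<open>The middle term is charged to every vertex placed close to \<open>v\<close>,
    heavy or light, so that it sums over all of them at once.\<close>
  have pointwise: "card (children T r u \<inter> E) * a u
      \<le> 2 * \<alpha> * n u + (if f u \<in> close v then d / (128 * (real t - 1)) * a u else 0)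
         + (if u \<in> heavy \<and> f u \<in> close v then d / 256 * a u else 0)" if u: "u \<in> E" for u
  proof -
    have uT: "u \<in> pverts T" using u PE by (auto simp: partial_embedding_def)
    have le: "card (children T r u \<inter> E) * a u \<le> n u * a u"
      using finite_children a0 by (auto simp: n_def intro!: mult_right_mono card_mono)
    consider "f u \<notin> close v" | "f u \<in> close v" "u \<in> heavy" | "f u \<in> close v" "u \<notin> heavy" by blast
    then show ?thesis
    proof cases
      case 1
      then have "a u \<le> 2 * \<alpha>" using f_verts[OF u] by (simp add: close_def a_def)
      then have "n u * a u \<le> n u * (2 * \<alpha>)" using n0 by (intro mult_left_mono) auto
      then show ?thesis using 1 le by (simp add: mult_ac)
    next
      case 2
      have "256 * n u \<le> d"
        using card_children_le[OF uT] degree_T by (simp add: n_def)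
      then have "n u * a u \<le> d / 256 * a u" using a0 by (intro mult_right_mono) auto
      moreover have "0 \<le> d / (128 * (real t - 1)) * a u" "0 \<le> 2 * \<alpha> * n u"
        using t_ge_2 a0 n0 \<alpha>_pos by auto
      ultimately show ?thesis using 2 le by simp
    next
      case 3
      then have "128 * (t - 1) * card (children T r u) \<le> d" using uT by (simp add: heavy_def)
      then have "real (128 * (t - 1) * card (children T r u)) \<le> real d"
        by (simp only: of_nat_le_iff)
      then have "n u \<le> d / (128 * (real t - 1))"
        using t_ge_2 by (simp add: n_def of_nat_diff field_simps)
      then have "n u * a u \<le> d / (128 * (real t - 1)) * a u" using a0 by (intro mult_right_mono) auto
      moreover have "0 \<le> 2 * \<alpha> * n u" using n0 \<alpha>_pos by simp
      ultimately show ?thesis using 3 le by simp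
    qed
  qed
  have "(\<Sum>u\<in>E. card (children T r u \<inter> E) * a u)
      \<le> (\<Sum>u\<in>E. 2 * \<alpha> * n u) + (\<Sum>u\<in>E. if f u \<in> close v then d / (128 * (real t - 1)) * a u else 0)
         + (\<Sum>u\<in>E. if u \<in> heavy \<and> f u \<in> close v then d / 256 * a u else 0)"
    using sum_mono[OF pointwise] by (simp add: sum.distrib)
  moreover have "(\<Sum>u\<in>E. 2 * \<alpha> * n u) \<le> (real d)\<^sup>2 / 32"
  proof -
    have "(\<Sum>u\<in>E. card (children T r u)) \<le> (\<Sum>u\<in>pverts T. card (children T r u))"
      using PE T.pair_finite_verts by (intro sum_mono2) (auto simp: partial_embedding_def)
    then have "(\<Sum>u\<in>E. card (children T r u)) \<le> card (pverts T)"
      using sum_card_children_le by simp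
    then have "(\<Sum>u\<in>E. n u) \<le> card (pverts T)"
      unfolding n_def by (simp only: of_nat_sum[symmetric] of_nat_le_iff)
    then have "2 * \<alpha> * (\<Sum>u\<in>E. n u) \<le> 2 * \<alpha> * card (pverts T)"
      using \<alpha>_pos by (intro mult_left_mono) auto
    then show ?thesis using card_T by (simp add: sum_distrib_left[symmetric])
  qed
  moreover have "(\<Sum>u\<in>E. if f u \<in> close v then d / (128 * (real t - 1)) * a u else 0) \<le> (real d)\<^sup>2 / 64"
  proof -
    let ?U = "{u \<in> E. f u \<in> close v}"
    have "inj_on f ?U"
      using PE by (auto simp: partial_embedding_def intro: inj_on_subset)
    then have "(\<Sum>u\<in>?U. a u) = (\<Sum>w\<in>f ` ?U. real (codeg v w))"
      by (simp add: sum.reindex a_def)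
    also have "\<dots> \<le> (\<Sum>w\<in>close v. real (codeg v w))"
      using finite_close by (intro sum_mono2) auto
    also have "\<dots> \<le> 2 * (real t - 1) * d" by (rule sum_codeg_close_le[OF v])
    finally have "d / (128 * (real t - 1)) * (\<Sum>u\<in>?U. a u) \<le> d / (128 * (real t - 1)) * (2 * (real t - 1) * d)"
      using t_ge_2 by (intro mult_left_mono) auto
    also have "\<dots> = (real d)\<^sup>2 / 64" using t_ge_2 by (simp add: power2_eq_square field_simps)
    finally show ?thesis
      unfolding sum.inter_filter[OF finite_E, symmetric] sum_distrib_left .
  qed
  moreover have "(\<Sum>u\<in>E. if u \<in> heavy \<and> f u \<in> close v then d / 256 * a u else 0) \<le> (real d)\<^sup>2 / 64"
  proof -
    let ?U = "{u. u \<in> E \<inter> heavy \<and> f u \<in> close v}"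
    have "d / 256 * (\<Sum>u\<in>?U. a u) \<le> d / 256 * (4 * d)"
      using sum_heavy_codeg_le[OF assms] by (intro mult_left_mono) (auto simp: a_def)
    also have "d / 256 * (4 * d) = (real d)\<^sup>2 / 64" by (simp add: power2_eq_square)
    also have "?U = {u \<in> E. u \<in> heavy \<and> f u \<in> close v}" by blast
    finally show ?thesis
      unfolding sum.inter_filter[OF finite_E, symmetric] sum_distrib_left .
  qed
  ultimately have "(\<Sum>u\<in>E. card (children T r u \<inter> E) * a u) \<le> (real d)\<^sup>2 / 16" by simp
  then have "2 / d * (\<Sum>u\<in>E. card (children T r u \<inter> E) * a u) \<le> 2 / d * ((real d)\<^sup>2 / 16)"
    by (intro mult_left_mono) auto
  moreover have "drift E f v = 2 / d * (\<Sum>u\<in>E. card (children T r u \<inter> E) * a u)"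
    by (simp add: drift_def a_def sum_distrib_left mult_ac)
  ultimately show ?thesis using d_pos by (simp add: power2_eq_square)
qed

text \<open>Otherwise \<open>v\<close> has at least \<open>d / 2\<close> hits, hence at least
  \<open>t\<close>, and is counted in the hit potential, which pushes \<open>Psi\<close> up to
  1.\<close>

lemma card_occupied_less:
  assumes "Psi E f < 1" and v: "v \<in> pverts G"
  shows "2 * card (Nplus v \<inter> f ` E) < d"
proof (rule ccontr)
  assume "\<not> ?thesis"
  then have k: "d \<le> 2 * hits E f v" by (simp add: hits_eq)
  have "exp (d / 4) \<le> exp (hits E f v / 2)" using k by simp
  also have "\<dots> = exp (1 / 2) ^ hits E f v" by (simp add: exp_of_nat_mult[symmetric])
  also have "\<dots> \<le> 2 ^ hits E f v"
  proof -
    \<comment> \<open>Squaring reduces the bound on the root of \<open>e\<close> to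
      \<open>exp 1 \<le> 4\<close>.\<close>
    have "(exp (1 / 2 :: real))\<^sup>2 \<le> 2\<^sup>2"
      using exp_le by (simp add: exp_double[symmetric])
    then have "exp (1 / 2 :: real) \<le> 2" by (rule power2_le_imp_le) simp
    then show ?thesis by (intro power_mono) auto
  qed
  finally have "exp (d / 4) * exp (- (d / 8)) \<le> 2 ^ hits E f v * exp (- drift E f v)"
    using drift_le[OF assms] by (intro mult_mono) auto
  also have "\<dots> \<le> hit_potential E f"
    using k d_ge v card_hit_le G.pair_finite_verts by (intro active_le_potential) auto
  finally have "exp (- real d / 8) * (exp (d / 4) * exp (- (d / 8))) \<le> exp (- real d / 8) * hit_potential E f"
    by (intro mult_left_mono) auto
  then have "1 \<le> exp (- real d / 8) * hit_potential E f"
    by (simp add: exp_add[symmetric])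
  moreover have "0 \<le> exp 1 / xheavy ^ 5 * heavy_potential E f"
    using heavy_potential_nonneg xheavy_pos by simp
  ultimately show False using assms by (simp add: Psi_def split: if_splits)
qed

section \<open>Placing one more child\<close>

context
  fixes u c :: 'a
  assumes u: "u \<in> E" and c: "c \<in> children T r u" "c \<notin> E"
begin

lemma partial_embedding_step:
  assumes "y \<in> Nplus (f u) - f ` E"
  shows "partial_embedding (insert c E) (f(c := y))"
proof -
  have y: "y \<in> pverts G" using assms Nplus_verts f_verts[OF u] by blast
  have inj: "inj_on (f(c := y)) (insert c E)"
    using PE c assms by (auto simp: partial_embedding_def inj_on_def)
  have new: "u' \<in> insert c E \<and> (f(c := y)) c' \<in> Nplus ((f(c := y)) u')"
    if "c' \<in> children T r u'" "c' \<in> insert c E" for u' c'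
  proof (cases "c' = c")
    case True
    then have "u' = u" using that parent_unique c by blast
    then show ?thesis using True u c assms by auto
  next
    case False
    then have "u' \<in> E" "f c' \<in> Nplus (f u')"
      using that PE by (auto simp: partial_embedding_def)
    then show ?thesis using False c by auto
  qed
  have "f(c := y) ` insert c E \<subseteq> pverts G"
    using PE c y by (auto simp: partial_embedding_def)
  then show ?thesis
    unfolding partial_embedding_def
    using PE c children_subset new inj unfolding partial_embedding_def by blast
qed

lemma hits_step:
  "hits (insert c E) (f(c := y)) v = hits E f v + (if y \<in> Nplus v then 1 else 0)"
proof -
  have "{w \<in> insert c E. (f(c := y)) w \<in> Nplus v}
      = (if y \<in> Nplus v then insert c {w \<in> E. f w \<in> Nplus v} else {w \<in> E. f w \<in> Nplus v})"
    using c by auto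
  then show ?thesis using c finite_E by (simp add: hits_def)
qed

lemma heavy_hits_step:
  "heavy_hits (insert c E) (f(c := y)) v
     = heavy_hits E f v + (if y \<in> (if c \<in> heavy then close v else {}) then 1 else 0)"
proof -
  have "{w \<in> insert c E \<inter> heavy. (f(c := y)) w \<in> close v}
      = (if c \<in> heavy \<and> y \<in> close v then insert c {w \<in> E \<inter> heavy. f w \<in> close v}
         else {w \<in> E \<inter> heavy. f w \<in> close v})"
    using c by auto
  then show ?thesis using c finite_E by (simp add: heavy_hits_def)
qed

lemma heavy_drift_step:
  "heavy_drift (insert c E) = heavy_drift E + (if c \<in> heavy then 1 / (2 * wmax) else 0)"
  using c finite_E by (simp add: heavy_drift_def add_divide_distrib)

text \<open>The increment is independent of the position \<open>y\<close> of \<open>c\<close>, as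
  \<open>sum_potential_le\<close> requires of the new compensator.\<close>

lemma drift_step: "drift (insert c E) (f(c := y)) v = drift E f v + 2 * codeg v (f u) / d"
proof -
  \<comment> \<open>A placed child of \<open>c\<close> would force \<open>c\<close> into
    \<open>E\<close>, which is closed under parents.\<close>
  have new: "children T r c \<inter> insert c E = {}"
    using PE c not_own_child by (auto simp: partial_embedding_def)
  have old: "card (children T r u' \<inter> insert c E)
      = card (children T r u' \<inter> E) + (if u' = u then 1 else 0)" for u'
  proof (cases "u' = u")
    case True
    then have "children T r u' \<inter> insert c E = insert c (children T r u' \<inter> E)" using c by auto
    then show ?thesis using True c finite_E by simp
  next
    case False
    then have "c \<notin> children T r u'" using parent_unique c by blast
    then show ?thesis using False by simp
  qed
  have "drift (insert c E) (f(c := y)) v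
      = (\<Sum>u'\<in>E. card (children T r u' \<inter> insert c E) * (2 * codeg v ((f(c := y)) u') / d))"
    using c finite_E new by (simp add: drift_def)
  also have "\<dots> = (\<Sum>u'\<in>E. card (children T r u' \<inter> E) * (2 * codeg v (f u') / d)
      + (if u' = u then 2 * codeg v (f u) / d else 0))"
    using c by (intro sum.cong) (auto simp: old algebra_simps add_divide_distrib)
  also have "\<dots> = drift E f v + 2 * codeg v (f u) / d"
    using u finite_E by (simp add: sum.distrib drift_def)
  finally show ?thesis .
qed

text \<open>The supermartingale property of \<open>Psi\<close> for a uniform choice among the free
  vertices, obtained separately for its two summands.\<close>

lemma sum_Psi_step_le:
  defines "X \<equiv> Nplus (f u) - f ` E"
  assumes X: "d \<le> 2 * card X"
  shows "(\<Sum>y\<in>X. Psi (insert c E) (f(c := y))) \<le> card X * Psi E f"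
proof -
  have finX: "finite X" using finite_Nplus[OF f_verts[OF u]] by (simp add: X_def)
  have neX: "X \<noteq> {}" using X d_pos by auto
  have cX: "real (card X) > 0" using finX neX by (simp add: card_gt_0_iff)
  \<comment> \<open>The free set still has at least \<open>d / 2\<close> elements; this is the
    source of the factor 2 in \<open>drift\<close>.\<close>
  have prob: "card (X \<inter> S) / card X \<le> 2 * b / d" if "card (X \<inter> S) \<le> b" for S and b :: real
  proof -
    have "real (card (X \<inter> S)) * d \<le> real (card (X \<inter> S)) * (2 * card X)"
      using X by (intro mult_left_mono) auto
    also have "\<dots> \<le> b * (2 * card X)"
      using that by (intro mult_right_mono) auto
    finally show ?thesis using cX d_pos by (simp add: field_simps)
  qed
  have drift_nonneg: "0 \<le> drift E' f' v" for E' f' v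
    unfolding drift_def by (intro sum_nonneg) auto
  have "(\<Sum>y\<in>X. hit_potential (insert c E) (f(c := y)))
      = (\<Sum>y\<in>X. potential 2 t hit_limit (pverts G) (hits (insert c E) (f(c := y)))
          (\<lambda>v. drift E f v + 2 * codeg v (f u) / d))"
    by (intro sum.cong arg_cong[where f = "potential _ _ _ _ _"] ext drift_step) auto
  also have "\<dots> \<le> card X * hit_potential E f"
  proof (rule sum_potential_le[where S = Nplus])
    fix v assume v: "v \<in> pverts G"
    show "0 \<le> drift E f v + 2 * codeg v (f u) / d" using drift_nonneg by simp
    have "card (X \<inter> Nplus v) \<le> codeg v (f u)"
      unfolding codeg_def X_def using finite_Nplus[OF v] by (intro card_mono) auto
    then show "drift E f v + (2 - 1) * (card (X \<inter> Nplus v) / card X) \<le> drift E f v + 2 * codeg v (f u) / d"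
      using prob[of "Nplus v" "codeg v (f u)"] by simp
  qed (use finX neX hits_step in auto)
  finally have 1: "(\<Sum>y\<in>X. hit_potential (insert c E) (f(c := y))) \<le> card X * hit_potential E f" .
  have 2: "(\<Sum>y\<in>X. heavy_potential (insert c E) (f(c := y))) \<le> card X * heavy_potential E f" if "t \<ge> 4"
  \<comment> \<open>With a light \<open>c\<close> neither the heavy hits nor the heavy drift change,
    which the empty hit set expresses.\<close>
  proof (rule sum_potential_le[where S = "\<lambda>v. if c \<in> heavy then close v else {}"])
    fix v assume v: "v \<in> pverts G"
    show "0 \<le> heavy_drift (insert c E)" using wmax_pos by (simp add: heavy_drift_def)
    have "(xheavy - 1) * (card (X \<inter> close v) / card X) \<le> xheavy * (2 * wmax / d)"
    proof (intro mult_mono prob)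
      have "card (X \<inter> close v) \<le> card (close v)" using finite_close by (intro card_mono) auto
      then show "card (X \<inter> close v) \<le> wmax" using card_close_le[OF v] by simp
    qed (use xheavy_pos in auto)
    also have "xheavy * (2 * wmax / d) = 1 / (2 * wmax)"
    proof -
      define k where "k = real t - 1"
      have "k > 0" using t_ge_2 by (simp add: k_def)
      then show ?thesis
        unfolding xheavy_def wmax_def k_def[symmetric]
        using \<alpha>_pos d_pos by (simp add: field_simps power2_eq_square)
    qed
    finally show "heavy_drift E + (xheavy - 1) * (card (X \<inter> (if c \<in> heavy then close v else {})) / card X)
        \<le> heavy_drift (insert c E)"
      by (simp add: heavy_drift_step)
  qed (use finX neX xheavy_ge_1 that heavy_hits_step in auto)
  have "(\<Sum>y\<in>X. Psi (insert c E) (f(c := y)))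
      = exp (- real d / 8) * (\<Sum>y\<in>X. hit_potential (insert c E) (f(c := y)))
        + (if t \<ge> 4 then exp 1 / xheavy ^ 5 * (\<Sum>y\<in>X. heavy_potential (insert c E) (f(c := y))) else 0)"
    by (simp add: Psi_def sum.distrib sum_distrib_left)
  also have "\<dots> \<le> exp (- real d / 8) * (card X * hit_potential E f)
        + (if t \<ge> 4 then exp 1 / xheavy ^ 5 * (card X * heavy_potential E f) else 0)"
  proof (intro add_mono mult_left_mono 1)
    have "exp 1 / xheavy ^ 5 * (\<Sum>y\<in>X. heavy_potential (insert c E) (f(c := y)))
        \<le> exp 1 / xheavy ^ 5 * (card X * heavy_potential E f)" if "t \<ge> 4"
      using 2[OF that] xheavy_pos by (intro mult_left_mono) auto
    then show "(if t \<ge> 4 then exp 1 / xheavy ^ 5 * (\<Sum>y\<in>X. heavy_potential (insert c E) (f(c := y))) else 0)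
        \<le> (if t \<ge> 4 then exp 1 / xheavy ^ 5 * (card X * heavy_potential E f) else 0)"
      by (cases "t \<ge> 4") (simp_all only: if_True if_False order_refl)
  qed simp
  also have "\<dots> = card X * Psi E f"
    by (simp add: Psi_def algebra_simps)
  finally show ?thesis .
qed

end

end

lemma partial_embedding_root: "f r \<in> pverts G \<Longrightarrow> partial_embedding {r} f"
  using root root_not_child by (auto simp: partial_embedding_def)

text \<open>The root alone makes at most one hit of either kind, so no vertex is beyond its
  threshold and only the prepaid terms remain.\<close>

lemma Psi_root_le:
  "Psi {r} f \<le> exp (- real d / 8) * (hit_limit * 2 ^ t)
     + (if t \<ge> 4 then exp 1 / xheavy ^ 4 * (2 * wmax\<^sup>2) else 0)"
proof -
  have "hits {r} f v \<le> 1" "heavy_hits {r} f v \<le> 1" for v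
    unfolding hits_def heavy_hits_def by (rule order_trans[OF card_mono[of "{r}"]]; auto)+
  then have hits: "hits {r} f v \<le> t" "heavy_hits {r} f v \<le> 1" for v
    using t_ge_2 by (auto intro: order_trans[of _ 1])
  have "hit_potential {r} f \<le> hit_limit * 2 ^ t"
    by (rule potential_le_initial) (use hits in \<open>auto simp: drift_def\<close>)
  moreover have "heavy_potential {r} f \<le> 2 * wmax\<^sup>2 * xheavy ^ 1"
    by (rule potential_le_initial) (use hits xheavy_pos wmax_pos in \<open>auto simp: heavy_drift_def\<close>)
  then have "exp 1 / xheavy ^ 5 * heavy_potential {r} f \<le> exp 1 / xheavy ^ 5 * (2 * wmax\<^sup>2 * xheavy)"
    using xheavy_pos by (intro mult_left_mono) auto
  moreover have "exp 1 / xheavy ^ 5 * (2 * wmax\<^sup>2 * xheavy) = exp 1 / xheavy ^ 4 * (2 * wmax\<^sup>2)"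
    using xheavy_pos by (simp add: field_simps power_numeral_reduce)
  ultimately show ?thesis
    unfolding Psi_def by (auto intro!: add_mono mult_left_mono)
qed

end

section \<open>The success probability of the algorithm\<close>

lemma measure_bind_pmf_of_set:
  assumes "finite X" "X \<noteq> {}"
  shows "measure (measure_spmf (bind_pmf (pmf_of_set X) p)) A
    = (\<Sum>y\<in>X. measure (measure_spmf (p y)) A) / card X"
proof -
  have "ennreal (measure (measure_pmf (bind_pmf (pmf_of_set X) p)) (Some ` A))
      = (\<Sum>y\<in>X. ennreal (measure (measure_pmf (p y)) (Some ` A))) / card X"
    using assms
    by (simp add: measure_pmf.emeasure_eq_measure[symmetric] nn_integral_pmf_of_set)
  also have "\<dots> = ennreal ((\<Sum>y\<in>X. measure (measure_pmf (p y)) (Some ` A)) / card X)"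
    using assms by (simp add: ennreal_of_nat_eq_real_of_nat divide_ennreal sum_nonneg card_gt_0_iff)
  finally show ?thesis
    by (simp add: measure_measure_spmf_conv_measure_pmf sum_nonneg)
qed

lemma embedded_Cons [simp]: "embedded ((c, y) # h) = insert c (embedded h)"
  and occupied_Cons [simp]: "occupied ((c, y) # h) = insert y (occupied h)"
  by (simp_all add: embedded_def occupied_def)

lemma dom_map_of_embedded: "dom (map_of h) = embedded h"
  by (simp add: embedded_def dom_map_of_conv_image_fst)

text \<open>A total function, so that extending the log is a function update everywhere and the
  one-step lemmas apply directly.\<close>

definition position :: "('a, 'b) log \<Rightarrow> 'a \<Rightarrow> 'b" where
  "position h u = the (map_of h u)"

lemma position_Cons: "position ((c, y) # h) = (position h)(c := y)"
  by (auto simp: position_def)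

lemma map_of_position: "u \<in> embedded h \<Longrightarrow> map_of h u = Some (position h u)"
  unfolding dom_map_of_embedded[symmetric] by (auto simp: position_def)

locale algorithm2_run = greedy_embedding T r G Nplus s t d \<alpha>
  for T :: "'a pair_pre_digraph" and r and G :: "'b pair_pre_digraph" and Nplus s t d \<alpha> +
  fixes pick :: "('a, 'b) log \<Rightarrow> 'a" and ord :: "('a, 'b) log \<Rightarrow> 'a list"
  assumes selection: "selection_rule T r pick ord"
begin

abbreviation "success p \<equiv> measure (measure_spmf p) {f. is_embedding T G f}"

abbreviation "loop \<equiv> algorithm2_loop T Nplus pick ord"

abbreviation "log_Psi h \<equiv> Psi (embedded h) (position h)"

text \<open>The second condition excludes stale positions: \<open>occupied\<close> reads all log
  entries, \<open>map_of\<close> only the latest one for each tree vertex.\<close>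

definition valid_log :: "('a, 'b) log \<Rightarrow> bool" where
  "valid_log h \<longleftrightarrow> partial_embedding (embedded h) (position h) \<and>
     occupied h = position h ` embedded h"

text \<open>The invariant between two rounds of the loop. It makes every vertex with an unplaced
  child pending.\<close>

definition sibling_closed :: "'a set \<Rightarrow> bool" where
  "sibling_closed E \<longleftrightarrow> (\<forall>u\<in>E. children T r u \<subseteq> E \<or> children T r u \<inter> E = {})"

lemma card_free_ge:
  assumes "valid_log h" "log_Psi h < 1" "v \<in> pverts G"
  shows "d \<le> 2 * card (Nplus v - occupied h)"
proof -
  have "2 * card (Nplus v \<inter> occupied h) < d"
    using card_occupied_less[of "embedded h" "position h" v] assms by (simp add: valid_log_def)
  moreover have "card (Nplus v - occupied h) = d - card (Nplus v \<inter> occupied h)"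
    using finite_Nplus[OF assms(3)] card_Nplus[OF assms(3)] by (simp add: card_Diff_subset_Int)
  ultimately show ?thesis by simp
qed

text \<open>The bound \<open>1 - Psi\<close> is carried backwards through a batch of siblings. It is
  trivial once \<open>Psi \<ge> 1\<close>; otherwise at least half of the target set is free and
  \<open>Psi\<close> does not increase on average. \<open>F\<close> is the embedded set after the
  whole batch, where the bound is assumed.\<close>

lemma success_place:
  assumes IH: "\<And>h'. valid_log h' \<Longrightarrow> embedded h' = F \<Longrightarrow> 1 - log_Psi h' \<le> success (loop h')"
    and "valid_log h" "u \<in> embedded h" "distinct cs" "set cs \<subseteq> children T r u"
    and "set cs \<inter> embedded h = {}" "embedded h \<union> set cs = F"
  shows "1 - log_Psi h \<le> success (bind_pmf (place (Nplus (position h u)) cs h) loop)"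
  using assms(2-)
proof (induction cs arbitrary: h)
  case Nil
  then show ?case using IH by (simp add: bind_return_pmf)
next
  case (Cons c cs)
  let ?v = "position h u"
  show ?case
  proof (cases "log_Psi h < 1")
    case False
    have "1 - log_Psi h \<le> 0" using False by simp
    also have "0 \<le> success (bind_pmf (place (Nplus ?v) (c # cs) h) loop)" by simp
    finally show ?thesis .
  next
    case True
    define X where "X = Nplus ?v - occupied h"
    have PE: "partial_embedding (embedded h) (position h)"
      and occ: "occupied h = position h ` embedded h"
      using Cons.prems by (auto simp: valid_log_def)
    have v: "?v \<in> pverts G"
      using PE Cons.prems by (auto simp: partial_embedding_def)
    have c: "c \<in> children T r u" "c \<notin> embedded h" using Cons.prems by auto
    have X: "d \<le> 2 * card X"
      unfolding X_def using card_free_ge Cons.prems True v by blast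
    have finX: "finite X" using finite_Nplus[OF v] by (simp add: X_def)
    have neX: "X \<noteq> {}" using X d_pos by auto
    have cX: "real (card X) > 0" using finX neX by (simp add: card_gt_0_iff)
    have step: "1 - Psi (insert c (embedded h)) ((position h)(c := y))
        \<le> success (bind_pmf (place (Nplus ?v) cs ((c, y) # h)) loop)" if y: "y \<in> X" for y
    proof -
      have "valid_log ((c, y) # h)"
        using partial_embedding_step[OF PE Cons.prems(2) c, of y] y c occ
        by (auto simp: valid_log_def position_Cons X_def)
      moreover have "position ((c, y) # h) u = ?v"
        using c Cons.prems(2) by (auto simp: position_Cons)
      ultimately show ?thesis
        using Cons.IH[of "(c, y) # h"] Cons.prems by (simp add: position_Cons del: fun_upd_apply)
    qed
    have "card X * (1 - log_Psi h)
        \<le> (\<Sum>y\<in>X. 1 - Psi (insert c (embedded h)) ((position h)(c := y)))"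
      using sum_Psi_step_le[OF PE Cons.prems(2) c] X
      by (simp add: sum_subtractf algebra_simps X_def occ)
    also have "\<dots> \<le> (\<Sum>y\<in>X. success (bind_pmf (place (Nplus ?v) cs ((c, y) # h)) loop))"
      by (intro sum_mono step)
    finally have "1 - log_Psi h
        \<le> (\<Sum>y\<in>X. success (bind_pmf (place (Nplus ?v) cs ((c, y) # h)) loop)) / card X"
      using cX by (simp add: field_simps)
    also have "\<dots> = success (bind_pmf (place (Nplus ?v) (c # cs) h) loop)"
      using finX neX by (simp add: bind_assoc_pmf measure_bind_pmf_of_set X_def)
    finally show ?thesis .
  qed
qed

lemma is_embedding_final:
  assumes "valid_log h" "embedded h = pverts T"
  shows "is_embedding T G (map_of h)"
  unfolding is_embedding_def
proof (intro conjI ballI)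
  have PE: "partial_embedding (pverts T) (position h)"
    using assms by (simp add: valid_log_def)
  note map_of = map_of_position[of _ h, unfolded assms(2)]
  show dom: "dom (map_of h) = pverts T"
    using assms by (simp add: dom_map_of_embedded)
  show "ran (map_of h) \<subseteq> pverts G"
  proof
    fix y assume "y \<in> ran (map_of h)"
    then obtain u where "map_of h u = Some y" by (auto simp: ran_def)
    then have "u \<in> pverts T" "y = position h u" using dom by (auto simp: position_def)
    then show "y \<in> pverts G" using PE by (auto simp: partial_embedding_def)
  qed
  show "inj_on (map_of h) (dom (map_of h))"
    using PE map_of by (auto simp: dom partial_embedding_def inj_on_def)
  fix e assume e: "e \<in> parcs T"
  obtain u v where uv: "e = (u, v)" by (cases e)
  have arc: "(position h u, position h v) \<in> parcs G" if "v \<in> children T r u" "u \<in> pverts T" for u v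
  proof -
    have "v \<in> pverts T" using that children_subset by blast
    then have "position h v \<in> Nplus (position h u)" "position h u \<in> pverts G"
      using PE that by (auto simp: partial_embedding_def)
    then show ?thesis using Nplus_subset by (auto simp: mem_nbhd_iff[symmetric])
  qed
  have "u \<in> pverts T" "v \<in> pverts T" using e uv T.in_arcsD1 T.in_arcsD2 by auto
  then have "(position h u, position h v) \<in> parcs G"
    using child_or_parent[of u v] e uv arc parcs_G_sym by blast
  then show "case e of (u, v) \<Rightarrow> (the (map_of h u), the (map_of h v)) \<in> parcs G"
    by (simp add: uv position_def)
qed

lemma sibling_closed_insert_children:
  assumes PE: "partial_embedding E f" and closed: "sibling_closed E"
    and u: "u \<in> E" "children T r u \<inter> E = {}"
  shows "sibling_closed (E \<union> children T r u)"
  unfolding sibling_closed_def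
proof
  fix w assume w: "w \<in> E \<union> children T r u"
  show "children T r w \<subseteq> E \<union> children T r u \<or> children T r w \<inter> (E \<union> children T r u) = {}"
  proof (cases "w = u")
    case False
    then have disj: "children T r w \<inter> children T r u = {}"
      using parent_unique by blast
    show ?thesis
    proof (cases "w \<in> E")
      case True
      then show ?thesis using closed disj unfolding sibling_closed_def by blast
    next
      case False
      \<comment> \<open>Here \<open>w\<close> is newly placed; a child of it in \<open>E\<close>
        would require \<open>w\<close> in \<open>E\<close>.\<close>
      then have "children T r w \<inter> E = {}"
        using PE unfolding partial_embedding_def by blast
      then show ?thesis using disj by blast
    qed
  qed simp
qed

text \<open>Induction on the number of unplaced vertices, with the bound for all later logs fed into
  \<open>success_place\<close>.\<close>

lemma success_loop:
  assumes "valid_log h" "sibling_closed (embedded h)"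
  shows "1 - log_Psi h \<le> success (loop h)"
  using assms
proof (induction "card (pverts T - embedded h)" arbitrary: h rule: less_induct)
  case less
  have PE: "partial_embedding (embedded h) (position h)"
    and occ: "occupied h = position h ` embedded h"
    using less.prems by (auto simp: valid_log_def)
  have sub: "embedded h \<subseteq> pverts T" using PE by (simp add: partial_embedding_def)
  consider "embedded h = pverts T" | "log_Psi h \<ge> 1" | "embedded h \<noteq> pverts T" "log_Psi h < 1"
    by linarith
  then show ?case
  proof cases
    case 1
    have "loop h = return_spmf (map_of h)"
      using 1 by (subst algorithm2_loop.simps) simp
    then have "success (loop h) = 1"
      using is_embedding_final[OF less.prems(1) 1]
      by (simp add: measure_measure_spmf_conv_measure_pmf indicator_def)
    then show ?thesis using Psi_nonneg[OF PE] by simp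
  next
    case 2
    then have "1 - log_Psi h \<le> 0" by simp
    also have "0 \<le> success (loop h)" by simp
    finally show ?thesis .
  next
    case 3
    define u where "u = pick h"
    have "r \<in> embedded h" "embedded h \<subset> pverts T"
      using PE sub 3 by (auto simp: partial_embedding_def)
    then obtain w where w: "w \<in> embedded h" "\<not> children T r w \<subseteq> embedded h"
      using frontier_exists by blast
    moreover from w have "children T r w \<inter> embedded h = {}"
      using less.prems(2) by (auto simp: sibling_closed_def)
    ultimately have "w \<in> pending T r h" by (auto simp: pending_def)
    then have "pick h \<in> pending T r h" "distinct (ord h)" and ord: "set (ord h) = children T r (pick h)"
      using selection by (auto simp: selection_rule_def)
    then have u: "u \<in> embedded h" "children T r u \<noteq> {}" "children T r u \<inter> embedded h = {}"
      by (auto simp: pending_def u_def)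
    have v: "position h u \<in> pverts G" using u PE by (auto simp: partial_embedding_def)
    have "length (ord h) = card (children T r u)"
      using \<open>distinct (ord h)\<close> ord by (metis distinct_card u_def)
    also have "\<dots> \<le> max_degree T"
      using u sub by (intro card_children_le) auto
    \<comment> \<open>At least \<open>d / 2\<close> vertices are free, while the degree bound allows
      at most \<open>d / 256\<close> children: this round cannot fail.\<close>
    also have "\<dots> \<le> card (Nplus (position h u) - occupied h)"
      using card_free_ge[OF less.prems(1) 3(2) v] degree_T by simp
    finally have "loop h = bind_pmf (place (Nplus (position h u)) (ord h) h) loop"
      using 3 by (subst algorithm2_loop.simps) (simp add: Let_def position_def u_def)
    moreover have "1 - log_Psi h \<le> success (bind_pmf (place (Nplus (position h u)) (ord h) h) loop)"
    proof (rule success_place)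
      fix h' :: "('a, 'b) log"
      assume h': "valid_log h'" "embedded h' = embedded h \<union> children T r u"
      have "pverts T - embedded h' \<subset> pverts T - embedded h"
        using h'(2) u children_subset by blast
      then have "card (pverts T - embedded h') < card (pverts T - embedded h)"
        using T.pair_finite_verts by (intro psubset_card_mono) auto
      moreover have "sibling_closed (embedded h')"
        unfolding h'(2) using sibling_closed_insert_children PE less.prems(2) u by blast
      ultimately show "1 - log_Psi h' \<le> success (loop h')"
        using less.hyps h'(1) by blast
    qed (use less.prems u ord \<open>distinct (ord h)\<close> u_def in auto)
    ultimately show ?thesis by simp
  qed
qed

lemma success_algorithm2:
  assumes x: "x \<in> pverts G"
  shows "1 - (exp (- real d / 8) * (hit_limit * 2 ^ t)
      + (if t \<ge> 4 then exp 1 / xheavy ^ 4 * (2 * wmax\<^sup>2) else 0))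
    \<le> success (algorithm2 T Nplus r x pick ord)"
proof -
  have emb: "embedded [(r, x)] = {r}" and pos: "position [(r, x)] r = x"
    by (simp_all add: embedded_def position_def)
  have "valid_log [(r, x)]"
    using partial_embedding_root[of "position [(r, x)]"] x
    by (simp only: valid_log_def emb pos) (simp add: occupied_def pos)
  moreover have "sibling_closed (embedded [(r, x)])"
    using root_not_child by (simp add: emb sibling_closed_def del: embedded_Cons)
  ultimately have "1 - log_Psi [(r, x)] \<le> success (loop [(r, x)])"
    by (rule success_loop)
  then show ?thesis
    using Psi_root_le[of "position [(r, x)]"] by (simp add: algorithm2_def emb del: embedded_Cons)
qed

end

section \<open>Asymptotics\<close>

context greedy_embedding
begin

lemma wmax_square: "wmax\<^sup>2 = d / (4 * xheavy)"
proof -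
  define k where "k = real t - 1"
  have "k > 0" using t_ge_2 by (simp add: k_def)
  then show ?thesis
    unfolding xheavy_def wmax_def k_def[symmetric]
    using \<alpha>_pos d_pos by (simp add: field_simps power2_eq_square)
qed

text \<open>Removes all dependence on \<open>G\<close> and \<open>T\<close>:
  \<open>|T| \<le> d^2\<close> because \<open>\<alpha> \<ge> 1\<close>, and
  \<open>wmax_square\<close> leaves a quantity decreasing in \<open>xheavy\<close>, for which a
  lower bound \<open>y\<close> suffices.\<close>

lemma failure_bound_le:
  assumes \<alpha>_ge_1: "\<alpha> \<ge> 1" and y: "0 < y" "t \<ge> 4 \<Longrightarrow> y \<le> xheavy"
  shows "exp (- real d / 8) * (hit_limit * 2 ^ t)
      + (if t \<ge> 4 then exp 1 / xheavy ^ 4 * (2 * wmax\<^sup>2) else 0)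
    \<le> exp (- real d / 8) * (s * real d ^ (2 * t) * 2 ^ t) + exp 1 * d / (2 * y ^ 5)"
proof (intro add_mono mult_left_mono mult_right_mono)
  have "1 * real (card (pverts T)) \<le> 64 * \<alpha> * card (pverts T)"
    using \<alpha>_ge_1 by (intro mult_right_mono) auto
  then have "real (card (pverts T)) \<le> (real d)\<^sup>2" using card_T by linarith
  then have "real (card (pverts T)) ^ t \<le> real d ^ (2 * t)"
    by (simp add: power_mono power_mult)
  then show "hit_limit \<le> s * real d ^ (2 * t)"
    by (simp add: mult_left_mono)
  show "(if t \<ge> 4 then exp 1 / xheavy ^ 4 * (2 * wmax\<^sup>2) else 0) \<le> exp 1 * d / (2 * y ^ 5)"
  proof (cases "t \<ge> 4")
    case True
    have "exp 1 / xheavy ^ 4 * (2 * wmax\<^sup>2) = exp 1 * d / (2 * xheavy ^ 5)"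
      unfolding wmax_square using xheavy_pos by (simp add: field_simps power_numeral_reduce)
    also have "\<dots> \<le> exp 1 * d / (2 * y ^ 5)"
      using y True by (intro divide_left_mono mult_left_mono power_mono mult_pos_pos) (auto simp: xheavy_pos)
    finally show ?thesis using True by simp
  qed (use y in auto)
qed auto

end

text \<open>The exponential beats the polynomial, and the second term has order \<open>d\<close> to
  the power \<open>1 - 5/3\<close>.\<close>

lemma eventually_failure_bound:
  fixes s t :: nat and C \<epsilon> :: real
  assumes "C > 0" "\<epsilon> > 0"
  shows "\<forall>\<^sub>F d in sequentially. exp (- real d / 8) * (s * real d ^ (2 * t) * 2 ^ t)
      + exp 1 * d / (2 * (d powr (1 / 3) / C) ^ 5) \<le> \<epsilon>"
proof -
  have "((\<lambda>x::real. x ^ (2 * t) / exp x) \<longlongrightarrow> 0) at_top" by (rule tendsto_power_div_exp_0)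
  moreover have "filterlim (\<lambda>d. real d / 8) at_top sequentially" by real_asymp
  ultimately have "(\<lambda>d. (real d / 8) ^ (2 * t) / exp (real d / 8)) \<longlonglongrightarrow> 0"
    by (rule filterlim_compose)
  then have "(\<lambda>d. s * 2 ^ t * 8 ^ (2 * t) * ((real d / 8) ^ (2 * t) / exp (real d / 8))) \<longlonglongrightarrow> 0"
    by (rule tendsto_mult_right_zero)
  moreover have "s * 2 ^ t * 8 ^ (2 * t) * ((real d / 8) ^ (2 * t) / exp (real d / 8))
      = exp (- real d / 8) * (s * real d ^ (2 * t) * 2 ^ t)" for d
    by (simp add: exp_minus power_divide field_simps)
  ultimately have 1: "(\<lambda>d. exp (- real d / 8) * (s * real d ^ (2 * t) * 2 ^ t)) \<longlonglongrightarrow> 0" by simp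
  have 2: "(\<lambda>d. exp 1 * real d / (2 * (d powr (1 / 3) / C) ^ 5)) \<longlonglongrightarrow> 0"
    using \<open>C > 0\<close> by real_asymp
  show ?thesis
    using order_tendstoD(2)[OF tendsto_add[OF 1 2], of \<epsilon>] \<open>\<epsilon> > 0\<close>
    by (auto elim: eventually_mono)
qed

text \<open>The final failure bound involves only \<open>d\<close>, \<open>s\<close> and
  \<open>t\<close>, which makes the threshold on \<open>d\<close> uniform over graphs, trees and all
  choices of the algorithm.\<close>

theorem theorem3p5:
  fixes s t :: nat and \<epsilon> :: real
  assumes "s \<ge> t" and "t \<ge> 2" and "\<epsilon> > 0"
  shows "\<forall>\<^sub>F d in sequentially.
    \<forall>(G :: 'b pair_pre_digraph) (T :: 'a pair_pre_digraph) Nplus r x pick ord.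
      pair_graph G \<and> bipartite_free s t G \<and> min_degree G = d \<and>
      undirected_tree T \<and>
      real (card (pverts T))
        \<le> 1 / 64 * real s powr (- 1 / (real t - 1)) * real d powr (real t / (real t - 1)) \<and>
      real (max_degree T) \<le> 1 / 256 * real d \<and>
      (\<forall>v \<in> pverts G. Nplus v \<subseteq> nbhd G v \<and> card (Nplus v) = d) \<and>
      r \<in> pverts T \<and> x \<in> pverts G \<and> selection_rule T r pick ord
      \<longrightarrow> measure (measure_spmf (algorithm2 T Nplus r x pick ord)) {f. is_embedding T G f}
            \<ge> 1 - \<epsilon>"
proof -
  define k where "k = real t - 1"
  \<comment> \<open>Chosen so that \<open>xheavy\<close> equals
    \<open>\<alpha>^2 / (C d)\<close>.\<close>
  define C where "C = 4 * k\<^sup>2"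
  have k: "k \<ge> 1" using \<open>t \<ge> 2\<close> by (simp add: k_def)
  then have C: "C > 0" by (simp add: C_def)
  have "\<forall>\<^sub>F d in sequentially. C \<le> real d powr (1 / 3)"
    by real_asymp
  moreover have "\<forall>\<^sub>F d in sequentially. d \<ge> 2 * t"
    by (rule eventually_ge_at_top)
  moreover note eventually_failure_bound[OF C \<open>\<epsilon> > 0\<close>, of s t]
  ultimately show ?thesis
  proof eventually_elim
    case (elim d)
    show ?case
    proof (intro allI impI, elim conjE)
      fix G :: "'b pair_pre_digraph" and T :: "'a pair_pre_digraph" and Nplus r x
        and pick :: "('a, 'b) log \<Rightarrow> 'a" and ord :: "('a, 'b) log \<Rightarrow> 'a list"
      assume G: "pair_graph G" "bipartite_free s t G" and T: "undirected_tree T"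
        and card_T: "real (card (pverts T))
          \<le> 1 / 64 * real s powr (- 1 / (real t - 1)) * real d powr (real t / (real t - 1))"
        and deg: "real (max_degree T) \<le> 1 / 256 * real d"
        and Nplus: "\<forall>v \<in> pverts G. Nplus v \<subseteq> nbhd G v \<and> card (Nplus v) = d"
        and r: "r \<in> pverts T" and x: "x \<in> pverts G" and sel: "selection_rule T r pick ord"
      define \<alpha> where "\<alpha> = real s powr (1 / k) * real d powr ((k - 1) / k)"
      have s1: "real s \<ge> 1" using assms by simp
      have d1: "real d \<ge> 1" using elim(2) \<open>t \<ge> 2\<close> by simp
      have \<alpha>_ge: "\<alpha> \<ge> real d powr ((k - 1) / k)"
        using s1 k ge_one_powr_ge_zero[of "real s" "1 / k"] mult_right_mono[of 1 "real s powr (1 / k)" "real d powr ((k - 1) / k)"]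
        by (simp add: \<alpha>_def)
      then have \<alpha>1: "\<alpha> \<ge> 1"
        using ge_one_powr_ge_zero[of "real d" "(k - 1) / k"] d1 k by simp
      have \<alpha>_power: "\<alpha> ^ (t - 1) = real s * real d ^ (t - 2)"
      proof -
        have kt: "real (t - 1) = k" "real (t - 2) = k - 1"
          using \<open>t \<ge> 2\<close> by (simp_all add: k_def of_nat_diff)
        have "\<alpha> ^ (t - 1) = \<alpha> powr k"
          using powr_realpow[of \<alpha> "t - 1"] \<alpha>1 unfolding kt by simp
        also have "\<dots> = real s * real d powr real (t - 2)"
          using k s1 kt by (simp add: \<alpha>_def powr_mult powr_powr)
        finally show ?thesis using d1 by (simp add: powr_realpow)
      qed
      \<comment> \<open>The powers of \<open>s\<close> cancel, and the exponents of \<open>d\<close>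
        add up to \<open>((t - 2) + t) / (t - 1) = 2\<close>.\<close>
      have size: "64 * \<alpha> * card (pverts T) \<le> (real d)\<^sup>2"
      proof -
        have "64 * \<alpha> * card (pverts T)
            \<le> 64 * \<alpha> * (1 / 64 * real s powr (- 1 / k) * real d powr (real t / k))"
          using card_T \<alpha>1 by (intro mult_left_mono) (auto simp: k_def)
        also have "\<dots> = real s powr (1 / k + - 1 / k) * real d powr ((k - 1) / k + real t / k)"
          by (simp only: powr_add) (simp add: \<alpha>_def)
        also have "1 / k + - 1 / k = 0" by simp
        also have "(k - 1) / k + real t / k = 2"
          using k by (simp add: field_simps) (simp add: k_def)
        finally show ?thesis using s1 d1 by (simp add: powr_realpow)
      qed
      \<comment> \<open>For \<open>t \<ge> 4\<close> the exponent \<open>(t - 2) / (t - 1)\<close>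
        is at least \<open>2/3\<close>, so \<open>\<alpha>^2 / d\<close> is at least
        \<open>d\<close> to the power \<open>1/3\<close>; dividing by \<open>C\<close> bounds
        \<open>xheavy\<close> from below.\<close>
      define y where "y = real d powr (1 / 3) / C"
      have y1: "y \<ge> 1" using elim(1) C by (simp add: y_def)
      have large: "y * C * d \<le> \<alpha>\<^sup>2" if "t \<ge> 4"
      proof -
        have "2 / 3 \<le> (k - 1) / k" using that k by (simp add: field_simps k_def)
        then have "real d powr (2 / 3) \<le> \<alpha>"
          using \<alpha>_ge d1 powr_mono[of "2 / 3" "(k - 1) / k" "real d"] by simp
        then have "(real d powr (2 / 3))\<^sup>2 \<le> \<alpha>\<^sup>2" by (intro power_mono) auto
        moreover have "(real d powr (2 / 3))\<^sup>2 = real d powr (1 / 3) * real d powr 1"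
          unfolding power2_eq_square powr_add[symmetric] by simp
        ultimately show ?thesis using C d1 by (simp add: y_def)
      qed
      interpret algorithm2_run T r G Nplus s t d \<alpha> pick ord
      proof (intro algorithm2_run.intro greedy_embedding.intro rooted_tree.intro
          greedy_embedding_axioms.intro algorithm2_run_axioms.intro)
        show "4 * (real t - 1)\<^sup>2 * d \<le> \<alpha>\<^sup>2" if "t \<ge> 4"
        proof -
          have "1 * (C * d) \<le> y * (C * d)" using y1 C by (intro mult_right_mono) auto
          then show ?thesis using large[OF that] by (simp add: C_def k_def mult_ac)
        qed
        show "256 * max_degree T \<le> d" using deg by linarith
      qed (use G T Nplus r sel \<open>t \<ge> 2\<close> elim(2) \<alpha>1 \<alpha>_power size in auto)
      have "y \<le> xheavy" if "t \<ge> 4"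
        using large[OF that] C d1 by (simp add: xheavy_def C_def k_def field_simps)
      then have "exp (- real d / 8) * (hit_limit * 2 ^ t)
          + (if t \<ge> 4 then exp 1 / xheavy ^ 4 * (2 * wmax\<^sup>2) else 0) \<le> \<epsilon>"
        using failure_bound_le[OF \<alpha>1, of y] y1 elim(3) unfolding y_def by linarith
      then show "1 - \<epsilon> \<le> measure (measure_spmf (algorithm2 T Nplus r x pick ord)) {f. is_embedding T G f}"
        using success_algorithm2[OF x] by linarith
    qed
  qed
qed

end
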